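(* Let $W:\mathbb{R}\to\mathbb{R}$ be a fixed smooth nonnegative function with compact support in $[0,1]$, and write $\hat W(0)=\int_{\mathbb{R}}W(t)\,dt$. Let $N\geq 1$, let $\alpha_m$ ($m\in\mathbb{N}$) be complex numbers with $|\alpha_m|\leq 1$, and for a lattice $\lambda\subseteq\mathbb{Z}^2$ put $$\psi(\lambda,N,\alpha)=\sum_{\substack{(m,n)\in\lambda\\ 0<m\leq N,\ n\in\mathbb{Z}}}\alpha_m W\!\left(\frac{n}{N}\right).$$ Let $D,M_1\geq 1$ and let $\Lambda$ be a set of full-rank lattices in $\mathbb{Z}^2$ such that for each $\lambda\in\Lambda$: $D\leq\det\lambda<2D$; the greatest common divisor of the set $\{m:(m,n)\in\lambda\}$ of first coordinates of points of $\lambda$ is $1$; and, for the chosen reduced basis matrix $B=B(\lambda)$ of $\lambda$ (described in the context), $M_1\leq B_{11}<2M_1$. Suppose further that for each integer $m$ with $M_1\leq m<2M_1$ there is at most one $\lambda\in\Lambda$ with $B_{11}(\lambda)=m$. Let $\delta>0$. \begin{enumerate} \item If $D\leq N^{1-\delta}$ then for any $A>0$, $$\sum_{\lambda\in\Lambda}\left|\psi(\lambda,N,\alpha)-\frac{N\hat W(0)}{\det\lambda}\sum_{m\leq N}\alpha_m\right|\ll_{\delta,A}N^{-A}.$$ \item If $N^{1-\delta}\leq D<M_1N^{1-\delta}$ then for any $\epsilon>0$, $$\sum_{\lambda\in\Lambda}\left|\psi(\lambda,N,\alpha)-\frac{N\hat W(0)}{\det\lambda}\sum_{m\leq N}\alpha_m\right|\ll_{\epsilon,\delta}N^{1+2\delta+\epsilon}M_1^{-1/2}D^{1/2}.$$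 \end{enumerate} Implied constants may also depend on $W$.
   Context: For a lattice $\lambda\subseteq\mathbb{Z}^2$, a reduced basis is chosen as follows: $B_1$ is a nonzero element of $\lambda$ of minimal Euclidean length, and $B_2$ is an element of minimal Euclidean length among the elements of $\lambda$ that are not multiples of $B_1$ (when minimal vectors are not unique, any such choice may be made). Then $\{B_1,B_2\}$ is a basis of $\lambda$. Signs of $B_1,B_2$ are chosen so that $B_{11}\geq 0$ and $\det B=\det\lambda$, where $B$ is the $2\times 2$ matrix with rows $B_1=(B_{11},B_{12})$ and $B_2=(B_{21},B_{22})$. The notation $\ll_{a}$ means the inequality holds up to a constant depending only on the indicated parameters (and $W$). *)

theory Defs
  imports "HOL-Analysis.Analysis"
begin

definition smooth :: "(real \<Rightarrow> real) \<Rightarrow> bool" where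
  "smooth f \<longleftrightarrow> (\<forall>k::nat. (deriv ^^ k) f differentiable_on UNIV)"

definition det2 :: "int \<times> int \<Rightarrow> int \<times> int \<Rightarrow> int" where
  "det2 u v = fst u * snd v - snd u * fst v"

definition lattice_basis :: "int \<times> int \<Rightarrow> int \<times> int \<Rightarrow> (int \<times> int) set \<Rightarrow> bool" where
  "lattice_basis u v L \<longleftrightarrow> det2 u v \<noteq> 0 \<and>
     L = {(a * fst u + b * fst v, a * snd u + b * snd v) | a b. True}"

definition full_rank_lattice :: "(int \<times> int) set \<Rightarrow> bool" where
  "full_rank_lattice L \<longleftrightarrow> (\<exists>u v. lattice_basis u v L)"

definition lattice_det :: "(int \<times> int) set \<Rightarrow> int" where
  "lattice_det L = (THE d. \<exists>u v. lattice_basis u v L \<and> d = \<bar>det2 u v\<bar>)"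

lemma lattice_basis_det_dvd:
  assumes "lattice_basis u v L" "u' \<in> L" "v' \<in> L"
  shows "det2 u v dvd det2 u' v'"
proof -
  from assms obtain a b c d where
    "u' = (a * fst u + b * fst v, a * snd u + b * snd v)"
    "v' = (c * fst u + d * fst v, c * snd u + d * snd v)"
    by (auto simp: lattice_basis_def)
  then have "det2 u' v' = det2 u v * (a * d - b * c)"
    by (simp add: det2_def algebra_simps)
  then show ?thesis by simp
qed

lemma lattice_basis_mem:
  assumes "lattice_basis u v L"
  shows "u \<in> L" "v \<in> L"
proof -
  have "u = (1 * fst u + 0 * fst v, 1 * snd u + 0 * snd v)"
    and "v = (0 * fst u + 1 * fst v, 0 * snd u + 1 * snd v)"
    by simp_all
  then show "u \<in> L" "v \<in> L"
    using assms unfolding lattice_basis_def by blast+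
qed

text \<open>The determinant does not depend on the basis, so the description in
  \<^const>\<open>lattice_det\<close> is proper.\<close>

lemma lattice_det_eq:
  assumes "lattice_basis u v L"
  shows "lattice_det L = \<bar>det2 u v\<bar>"
  unfolding lattice_det_def
proof (rule the_equality)
  show "\<exists>u' v'. lattice_basis u' v' L \<and> \<bar>det2 u v\<bar> = \<bar>det2 u' v'\<bar>"
    using assms by blast
next
  fix d assume "\<exists>u' v'. lattice_basis u' v' L \<and> d = \<bar>det2 u' v'\<bar>"
  then obtain u' v' where B: "lattice_basis u' v' L" and d: "d = \<bar>det2 u' v'\<bar>"
    by blast
  have "det2 u v dvd det2 u' v'" "det2 u' v' dvd det2 u v"
    using assms B lattice_basis_det_dvd lattice_basis_mem by blast+
  then show "d = \<bar>det2 u v\<bar>"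
    unfolding d by (rule zdvd_antisym_abs[symmetric])
qed

definition euclid_len :: "int \<times> int \<Rightarrow> real" where
  "euclid_len v = norm (real_of_int (fst v), real_of_int (snd v))"

definition int_multiples :: "int \<times> int \<Rightarrow> (int \<times> int) set" where
  "int_multiples v = {(k * fst v, k * snd v) | k. True}"

text \<open>A reduced basis is in general not unique: this predicate describes all admissible choices.\<close>

definition reduced_basis :: "(int \<times> int) set \<Rightarrow> int \<times> int \<Rightarrow> int \<times> int \<Rightarrow> bool" where
  "reduced_basis L b1 b2 \<longleftrightarrow>
     b1 \<in> L \<and> b1 \<noteq> (0, 0) \<and>
     (\<forall>v\<in>L. v \<noteq> (0, 0) \<longrightarrow> euclid_len b1 \<le> euclid_len v) \<and>
     b2 \<in> L \<and> b2 \<notin> int_multiples b1 \<and>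
     (\<forall>v\<in>L. v \<notin> int_multiples b1 \<longrightarrow> euclid_len b2 \<le> euclid_len v) \<and>
     0 \<le> fst b1 \<and> det2 b1 b2 = lattice_det L"

text \<open>Only finitely many terms of the following sum are nonzero when \<open>W\<close> has compact support,
  but its index set is infinite, hence the infinite-sum operator.\<close>

definition psi ::
  "(real \<Rightarrow> real) \<Rightarrow> (int \<times> int) set \<Rightarrow> real \<Rightarrow> (nat \<Rightarrow> complex) \<Rightarrow> complex" where
  "psi W L N \<alpha> =
     (\<Sum>\<^sub>\<infinity>(m, n)\<in>{(m, n). (m, n) \<in> L \<and> 0 < m \<and> real_of_int m \<le> N}.
        \<alpha> (nat m) * complex_of_real (W (real_of_int n / N)))"

text \<open>\<open>B1 L\<close> and \<open>B2 L\<close> are the rows of the chosen reduced basis matrix of \<open>L\<close>.\<close>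

definition admissible_family ::
  "real \<Rightarrow> real \<Rightarrow> (int \<times> int) set set \<Rightarrow>
   ((int \<times> int) set \<Rightarrow> int \<times> int) \<Rightarrow> ((int \<times> int) set \<Rightarrow> int \<times> int) \<Rightarrow> bool" where
  "admissible_family D M1 \<Lambda> B1 B2 \<longleftrightarrow>
     (\<forall>L\<in>\<Lambda>. full_rank_lattice L \<and>
        D \<le> real_of_int (lattice_det L) \<and> real_of_int (lattice_det L) < 2 * D \<and>
        Gcd (fst ` L) = 1 \<and>
        reduced_basis L (B1 L) (B2 L) \<and>
        M1 \<le> real_of_int (fst (B1 L)) \<and> real_of_int (fst (B1 L)) < 2 * M1) \<and>
     (\<forall>m::int. M1 \<le> real_of_int m \<and> real_of_int m < 2 * M1 \<longrightarrow>
        (\<forall>L\<in>\<Lambda>. \<forall>L'\<in>\<Lambda>. fst (B1 L) = m \<and> fst (B1 L') = m \<longrightarrow> L = L'))"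

text \<open>Hence finite sums over an admissible family carry no hidden convention.\<close>

lemma admissible_family_finite:
  assumes "admissible_family D M1 \<Lambda> B1 B2"
  shows "finite \<Lambda>"
proof (rule finite_imageD)
  have "(\<lambda>L. fst (B1 L)) ` \<Lambda> \<subseteq> {\<lfloor>M1\<rfloor>..\<lceil>2 * M1\<rceil>}"
    using assms unfolding admissible_family_def by (fastforce simp: floor_le_iff le_ceiling_iff)
  then show "finite ((\<lambda>L. fst (B1 L)) ` \<Lambda>)"
    by (rule finite_subset) simp
  show "inj_on (\<lambda>L. fst (B1 L)) \<Lambda>"
    using assms unfolding admissible_family_def inj_on_def by metis
qed

end

theory Submission
  imports Defs
begin

text \<open>
  The gcd condition makes each lattice a set \<open>{(m, n). n \<equiv> c m (mod q)}\<close> with \<open>q = det \<lambda>\<close>. Detecting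
  this congruence by additive characters modulo \<open>q\<close> writes \<open>\<psi>\<close> as the average over \<open>h mod q\<close> of
  \<open>\<Sum>m. \<alpha> m e (h c m / q)\<close> times \<open>S (h / q)\<close>, where \<open>e x = exp (2 pi i x)\<close> and
  \<open>S \<theta> = \<Sum>n. W (n / N) e (- n \<theta>)\<close>.

  Replacing \<open>n\<close> by \<open>n + x\<close> makes \<open>S \<theta>\<close> a function of \<open>x\<close> that is multiplied by \<open>e \<theta>\<close> when \<open>x\<close> grows
  by 1 and whose derivatives are sums of the same kind, each smaller by a factor \<open>N\<close>. Hence
  \<open>S 0 = N \<integral>W + O (N powr (1 - k))\<close>, which gives the main term, and \<open>S \<theta>\<close> is at most of order
  \<open>N (N \<bar>e \<theta> - 1\<bar>) powr (- k)\<close>, so that frequencies \<open>h / q\<close> with \<open>\<bar>h\<bar> \<ge> D N powr (\<delta> - 1)\<close> are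
  negligible. In the first case only \<open>h = 0\<close> remains.

  In the second case, let \<open>(m, b)\<close> be the shortest vector. Then \<open>c / q = y / m + b / (q m)\<close> with \<open>y\<close>
  coprime to \<open>m\<close>, and partial summation removes \<open>b / (q m)\<close>, which is small because
  \<open>m\<^sup>2 + b\<^sup>2 \<le> 2 q\<close>. Since \<open>D N powr (\<delta> - 1) < M1 \<le> m\<close> and the \<open>m\<close> are distinct, the points
  \<open>h y / m\<close> with \<open>gcd h m = g\<close> are \<open>(g / (2 M1))\<^sup>2\<close>-spaced modulo 1, and summing the resulting large
  sieve bound over \<open>g\<close> gives the claim.
\<close>

section \<open>Additive characters\<close>

definition cis_2pi :: "real \<Rightarrow> complex" where
  "cis_2pi x = cis (2 * pi * x)"

lemma norm_cis_2pi [simp]: "norm (cis_2pi x) = 1"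
  by (simp add: cis_2pi_def)

lemma cis_2pi_add: "cis_2pi (x + y) = cis_2pi x * cis_2pi y"
  by (simp add: cis_2pi_def cis_mult distrib_left)

lemma cis_2pi_of_int [simp]: "cis_2pi (of_int k) = 1"
  by (simp add: cis_2pi_def)

lemma cis_2pi_0 [simp]: "cis_2pi 0 = 1"
  by (simp add: cis_2pi_def)

lemma cis_2pi_add_of_int [simp]: "cis_2pi (x + of_int k) = cis_2pi x"
  by (simp add: cis_2pi_add)

lemma cnj_cis_2pi: "cnj (cis_2pi x) = cis_2pi (- x)"
  by (simp add: cis_2pi_def cis_cnj)

lemma cis_2pi_diff: "cis_2pi (x - y) = cis_2pi x * cnj (cis_2pi y)"
  by (simp add: cnj_cis_2pi flip: cis_2pi_add)

lemma cis_2pi_of_nat_mult: "cis_2pi (real n * x) = cis_2pi x ^ n"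
  by (simp add: cis_2pi_def Complex.DeMoivre mult_ac)

definition centered_frac :: "real \<Rightarrow> real" where
  "centered_frac x = x - of_int (round x)"

definition dist_int :: "real \<Rightarrow> real" where
  "dist_int x = \<bar>centered_frac x\<bar>"

lemma dist_int_nonneg [simp]: "0 \<le> dist_int x"
  by (simp add: dist_int_def)

lemma dist_int_le_half: "dist_int x \<le> 1/2"
  using of_int_round_abs_le[of x] unfolding dist_int_def centered_frac_def by linarith

lemma dist_int_le: "dist_int x \<le> \<bar>x - of_int k\<bar>"
  unfolding dist_int_def centered_frac_def by (rule round_diff_minimal)

lemma dist_int_geI: "(\<And>k. r \<le> \<bar>x - of_int k\<bar>) \<Longrightarrow> r \<le> dist_int x"
  by (simp add: dist_int_def centered_frac_def)

lemma dist_int_diff_le: "dist_int (x - y) \<le> \<bar>centered_frac x - centered_frac y\<bar>"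
  using dist_int_le[of "x - y" "round x - round y"] by (simp add: centered_frac_def algebra_simps)

lemma sin_pi_mult_ge:
  assumes "0 \<le> x" "x \<le> 1/2"
  shows "2 * x \<le> sin (pi * x)"
proof -
  have "concave_on {0..pi} sin"
    by (rule f''_le0_imp_concave[where f' = cos and f'' = "\<lambda>x. - sin x"])
      (auto intro!: derivative_eq_intros sin_ge_zero)
  from concave_onD[OF this, of "2 * x" 0 "pi / 2"] assms show ?thesis
    by (simp add: mult.commute)
qed

lemma norm_cis_2pi_minus_1_le: "norm (cis_2pi x - 1) \<le> 2 * pi * \<bar>x\<bar>"
  using dist_exp_i_1[of "2 * pi * x"] abs_sin_x_le_abs_x[of "pi * x"]
  by (simp add: cis_2pi_def cis_conv_exp abs_mult)

lemma norm_cis_2pi_minus_1_ge: "4 * dist_int x \<le> norm (cis_2pi x - 1)"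
proof -
  have "cis_2pi x = cis_2pi (centered_frac x)"
    using cis_2pi_add_of_int[of x "- round x"] by (simp add: centered_frac_def)
  also have "norm (\<dots> - 1) = 2 * \<bar>sin (pi * centered_frac x)\<bar>"
    using dist_exp_i_1[of "2 * pi * centered_frac x"] by (simp add: cis_2pi_def cis_conv_exp)
  also have "\<bar>sin (pi * centered_frac x)\<bar> = \<bar>sin (pi * dist_int x)\<bar>"
    by (simp add: dist_int_def abs_if)
  finally show ?thesis
    using sin_pi_mult_ge[OF dist_int_nonneg dist_int_le_half, of x] by linarith
qed

lemma sum_cis_2pi_residues:
  fixes q :: nat and j :: int
  assumes "q > 0"
  shows "(\<Sum>h<q. cis_2pi (real h * (of_int j / real q))) = (if int q dvd j then of_nat q else 0)"
proof -
  define z where "z = cis_2pi (of_int j / real q)"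
  have "z = 1 \<longleftrightarrow> int q dvd j"
  proof
    assume "z = 1"
    then have "dist_int (of_int j / real q) = 0"
      using norm_cis_2pi_minus_1_ge[of "of_int j / real q"] dist_int_nonneg[of "of_int j / real q"]
      by (simp add: z_def)
    then have "of_int j = real_of_int (int q * round (of_int j / real q))"
      using assms by (simp add: dist_int_def centered_frac_def field_simps)
    then show "int q dvd j"
      by (metis of_int_eq_iff dvd_triv_left)
  next
    assume "int q dvd j"
    then show "z = 1" using assms by (auto simp: z_def)
  qed
  moreover have "z ^ q = 1"
    using assms by (simp add: z_def flip: cis_2pi_of_nat_mult)
  ultimately have "(\<Sum>h<q. z ^ h) = (if int q dvd j then of_nat q else 0)"
    by (cases "z = 1") (auto simp: geometric_sum)
  then show ?thesis
    by (simp only: cis_2pi_of_nat_mult z_def)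
qed

section \<open>Exponential sums and a large sieve inequality\<close>

definition expsum :: "(nat \<Rightarrow> complex) \<Rightarrow> nat \<Rightarrow> real \<Rightarrow> complex" where
  "expsum \<alpha> t \<theta> = (\<Sum>m\<in>{1..t}. \<alpha> m * cis_2pi (real m * \<theta>))"

lemma expsum_Suc: "expsum \<alpha> (Suc t) \<theta> = expsum \<alpha> t \<theta> + \<alpha> (Suc t) * cis_2pi (real (Suc t) * \<theta>)"
  by (simp add: expsum_def)

lemma norm_expsum_le:
  assumes "\<And>m. norm (\<alpha> m) \<le> 1"
  shows "norm (expsum \<alpha> t \<theta>) \<le> real t"
proof -
  have "norm (expsum \<alpha> t \<theta>) \<le> (\<Sum>m\<in>{1..t}. 1)"
    unfolding expsum_def by (rule sum_norm_le) (simp add: norm_mult assms)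
  then show ?thesis by simp
qed

lemma expsum_add_of_int: "expsum \<alpha> t (\<theta> + of_int k) = expsum \<alpha> t \<theta>"
proof -
  have "cis_2pi (real m * (\<theta> + of_int k)) = cis_2pi (real m * \<theta>)" for m
    using cis_2pi_add_of_int[of "real m * \<theta>" "int m * k"] by (simp add: distrib_left)
  then show ?thesis by (simp add: expsum_def)
qed

lemma norm_expsum_uminus: "norm (expsum \<alpha> t (- \<theta>)) = norm (expsum (cnj \<circ> \<alpha>) t \<theta>)"
proof -
  have "expsum \<alpha> t (- \<theta>) = cnj (expsum (cnj \<circ> \<alpha>) t \<theta>)"
    by (simp add: expsum_def cnj_cis_2pi)
  then show ?thesis by (simp only: complex_mod_cnj)
qed

lemma norm_expsum_1_mult_dist_int_le: "norm (expsum (\<lambda>_. 1) t s) * dist_int s \<le> 1/2"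
proof -
  let ?z = "cis_2pi s"
  have "(?z - 1) * expsum (\<lambda>_. 1) t s = ?z ^ Suc t - ?z"
    unfolding expsum_def cis_2pi_of_nat_mult by (induction t) (simp_all add: algebra_simps)
  then have "norm (?z - 1) * norm (expsum (\<lambda>_. 1) t s) \<le> norm (?z ^ Suc t) + norm ?z"
    by (metis norm_mult norm_triangle_ineq4)
  moreover have "4 * (norm (expsum (\<lambda>_. 1) t s) * dist_int s)
      \<le> norm (?z - 1) * norm (expsum (\<lambda>_. 1) t s)"
    using mult_right_mono[OF norm_cis_2pi_minus_1_ge[of s] norm_ge_zero[of "expsum (\<lambda>_. 1) t s"]]
    by (simp only: mult_ac)
  ultimately show ?thesis
    unfolding norm_power norm_cis_2pi by simp
qed

definition well_spaced :: "real \<Rightarrow> ('a \<Rightarrow> real) \<Rightarrow> 'a set \<Rightarrow> bool" where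
  "well_spaced \<Delta> x P \<longleftrightarrow> (\<forall>p\<in>P. \<forall>p'\<in>P. p \<noteq> p' \<longrightarrow> \<Delta> \<le> dist_int (x p - x p'))"

lemma abs_diff_less_of_floor_eq:
  fixes a b \<Delta> :: real
  assumes "0 < \<Delta>" "\<lfloor>a / \<Delta>\<rfloor> = \<lfloor>b / \<Delta>\<rfloor>"
  shows "\<bar>a - b\<bar> < \<Delta>"
proof -
  have "\<bar>a / \<Delta> - b / \<Delta>\<bar> < 1" using assms(2) by linarith
  moreover have "a / \<Delta> - b / \<Delta> = (a - b) / \<Delta>" by (simp add: diff_divide_distrib)
  ultimately show ?thesis using assms(1) by (simp add: abs_if field_simps split: if_splits)
qed

lemma well_spaced_inj_on_cell:
  assumes \<Delta>: "\<Delta> > 0" and spaced: "well_spaced \<Delta> x P"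
    and side: "\<And>p p'. p \<in> P \<Longrightarrow> p' \<in> P \<Longrightarrow>
      0 \<le> centered_frac (x p - y) \<longleftrightarrow> 0 \<le> centered_frac (x p' - y)"
  shows "inj_on (\<lambda>p. nat \<lfloor>dist_int (x p - y) / \<Delta>\<rfloor>) P"
proof (rule inj_onI, rule ccontr)
  fix p p'
  assume p: "p \<in> P" "p' \<in> P" "p \<noteq> p'"
    and cell: "nat \<lfloor>dist_int (x p - y) / \<Delta>\<rfloor> = nat \<lfloor>dist_int (x p' - y) / \<Delta>\<rfloor>"
  have "\<lfloor>dist_int (x p - y) / \<Delta>\<rfloor> = \<lfloor>dist_int (x p' - y) / \<Delta>\<rfloor>"
    using cell \<Delta> by (simp add: nat_eq_iff2)
  then have "\<bar>dist_int (x p - y) - dist_int (x p' - y)\<bar> < \<Delta>"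
    by (rule abs_diff_less_of_floor_eq[OF \<Delta>])
  moreover have "\<bar>centered_frac (x p - y) - centered_frac (x p' - y)\<bar>
      = \<bar>dist_int (x p - y) - dist_int (x p' - y)\<bar>"
    using side[OF p(1,2)] by (auto simp: dist_int_def)
  ultimately have "dist_int (x p - x p') < \<Delta>"
    using dist_int_diff_le[of "x p - y" "x p' - y"] by simp
  then show False using spaced p unfolding well_spaced_def by (meson not_le)
qed

definition cell_bound :: "nat \<Rightarrow> real \<Rightarrow> nat \<Rightarrow> real" where
  "cell_bound t \<Delta> j = (if j = 0 then real t else 1 / (2 * (real j * \<Delta>)))"

lemma norm_expsum_1_le_cell_bound:
  assumes "\<Delta> > 0"
  shows "norm (expsum (\<lambda>_. 1) t s) \<le> cell_bound t \<Delta> (nat \<lfloor>dist_int s / \<Delta>\<rfloor>)"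
proof (cases "nat \<lfloor>dist_int s / \<Delta>\<rfloor>")
  case 0
  then show ?thesis using norm_expsum_le[of "\<lambda>_. 1" t s] by (simp add: cell_bound_def)
next
  case (Suc j)
  then have "real (Suc j) \<le> dist_int s / \<Delta>" by linarith
  then have "real (Suc j) * \<Delta> \<le> dist_int s" using assms by (simp add: pos_le_divide_eq)
  then have "norm (expsum (\<lambda>_. 1) t s) * (real (Suc j) * \<Delta>) \<le> 1/2"
    using norm_expsum_1_mult_dist_int_le[of t s] by (meson mult_left_mono norm_ge_zero order_trans)
  moreover have "0 < real (Suc j) * \<Delta>" using assms by simp
  ultimately have "norm (expsum (\<lambda>_. 1) t s) \<le> 1/2 / (real (Suc j) * \<Delta>)"
    by (simp only: pos_le_divide_eq)
  with Suc show ?thesis by (simp add: cell_bound_def)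
qed

lemma sum_cell_bound: "(\<Sum>j\<le>n. cell_bound t \<Delta> j) = real t + harm n / (2 * \<Delta>)"
proof -
  have "(\<Sum>j\<le>n. cell_bound t \<Delta> j) = cell_bound t \<Delta> 0 + (\<Sum>j\<in>{1..n}. cell_bound t \<Delta> j)"
    by (simp add: atMost_atLeast0 sum.atLeast_Suc_atMost)
  also have "(\<Sum>j\<in>{1..n}. cell_bound t \<Delta> j) = (\<Sum>j\<in>{1..n}. inverse (real j) / (2 * \<Delta>))"
    by (intro sum.cong) (auto simp: cell_bound_def field_simps)
  finally show ?thesis
    by (simp add: cell_bound_def harm_def flip: sum_divide_distrib)
qed

lemma sum_norm_expsum_1_le_one_sided:
  assumes \<Delta>: "\<Delta> > 0" and n: "1 / (2 * \<Delta>) \<le> real n" and "well_spaced \<Delta> x P"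
    and "\<And>p p'. p \<in> P \<Longrightarrow> p' \<in> P \<Longrightarrow>
      0 \<le> centered_frac (x p - y) \<longleftrightarrow> 0 \<le> centered_frac (x p' - y)"
  shows "(\<Sum>p\<in>P. norm (expsum (\<lambda>_. 1) t (x p - y))) \<le> real t + harm n / (2 * \<Delta>)"
proof -
  define cell where "cell p = nat \<lfloor>dist_int (x p - y) / \<Delta>\<rfloor>" for p
  have "(\<Sum>p\<in>P. norm (expsum (\<lambda>_. 1) t (x p - y))) \<le> (\<Sum>p\<in>P. cell_bound t \<Delta> (cell p))"
    unfolding cell_def by (intro sum_mono norm_expsum_1_le_cell_bound \<Delta>)
  also have "\<dots> = sum (cell_bound t \<Delta>) (cell ` P)"
    using well_spaced_inj_on_cell[OF \<Delta> assms(3,4)] by (simp add: sum.reindex cell_def)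
  also have "\<dots> \<le> sum (cell_bound t \<Delta>) {..n}"
  proof (rule sum_mono2)
    show "cell ` P \<subseteq> {..n}"
    proof safe
      fix p
      have "dist_int (x p - y) / \<Delta> \<le> (1/2) / \<Delta>"
        using \<Delta> dist_int_le_half by (intro divide_right_mono) auto
      then show "cell p \<le> n" using n by (simp add: cell_def; linarith)
    qed
  qed (use \<Delta> in \<open>auto simp: cell_bound_def\<close>)
  finally show ?thesis by (simp add: sum_cell_bound)
qed

lemma sum_norm_expsum_1_le:
  assumes "finite P" "\<Delta> > 0" "1 / (2 * \<Delta>) \<le> real n" "well_spaced \<Delta> x P"
  shows "(\<Sum>p\<in>P. norm (expsum (\<lambda>_. 1) t (x p - y))) \<le> 2 * real t + harm n / \<Delta>"
proof -
  let ?right = "{p \<in> P. 0 \<le> centered_frac (x p - y)}"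
    and ?f = "\<lambda>p. norm (expsum (\<lambda>_. 1) t (x p - y))"
  have spaced: "well_spaced \<Delta> x ?right" "well_spaced \<Delta> x (P - ?right)"
    using assms(4) by (auto simp: well_spaced_def)
  have "sum ?f P = sum ?f ?right + sum ?f (P - ?right)"
    using assms(1) by (subst sum.subset_diff[of ?right]) auto
  also have "\<dots> \<le> (real t + harm n / (2 * \<Delta>)) + (real t + harm n / (2 * \<Delta>))"
    using assms spaced by (intro add_mono sum_norm_expsum_1_le_one_sided) auto
  finally show ?thesis by simp
qed

lemma sum_norm_sq_trig_poly_le:
  assumes u: "\<And>p. norm (u p) \<le> 1"
  shows "(\<Sum>m\<in>{1..t}. (norm (\<Sum>p\<in>P. u p * cis_2pi (real m * x p)))\<^sup>2)
    \<le> (\<Sum>p\<in>P. \<Sum>p'\<in>P. norm (expsum (\<lambda>_. 1) t (x p' - x p)))"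
proof -
  define S where "S = (\<Sum>m\<in>{1..t}. (norm (\<Sum>p\<in>P. u p * cis_2pi (real m * x p)))\<^sup>2)"
  have "complex_of_real ((norm (\<Sum>p\<in>P. u p * cis_2pi (real m * x p)))\<^sup>2)
      = (\<Sum>p'\<in>P. \<Sum>p\<in>P. u p' * cnj (u p) * cis_2pi (real m * (x p' - x p)))" for m
    unfolding complex_norm_square cnj_sum sum_product right_diff_distrib cis_2pi_diff
    by (simp only: complex_cnj_mult mult_ac)
  then have "complex_of_real S
      = (\<Sum>m\<in>{1..t}. \<Sum>p'\<in>P. \<Sum>p\<in>P. u p' * cnj (u p) * cis_2pi (real m * (x p' - x p)))"
    by (simp add: S_def)
  also have "\<dots> = (\<Sum>p\<in>P. \<Sum>p'\<in>P. u p' * cnj (u p) * expsum (\<lambda>_. 1) t (x p' - x p))"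
    unfolding expsum_def sum_distrib_left
    by (subst sum.swap, subst (2) sum.swap, subst sum.swap) simp
  finally have "\<bar>S\<bar> = norm (\<Sum>p\<in>P. \<Sum>p'\<in>P. u p' * cnj (u p) * expsum (\<lambda>_. 1) t (x p' - x p))"
    by (simp flip: norm_of_real[where 'a = complex])
  also have "\<dots> \<le> (\<Sum>p\<in>P. \<Sum>p'\<in>P. norm (u p' * cnj (u p) * expsum (\<lambda>_. 1) t (x p' - x p)))"
    by (rule order_trans[OF norm_sum sum_mono[OF norm_sum]])
  also have "\<dots> \<le> (\<Sum>p\<in>P. \<Sum>p'\<in>P. norm (expsum (\<lambda>_. 1) t (x p' - x p)))"
    using mult_mono[OF u u] by (intro sum_mono) (simp add: norm_mult mult_left_le_one_le)
  finally show ?thesis by (simp add: S_def)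
qed

lemma sum_norm_expsum_le_of_row_sums:
  assumes \<alpha>: "\<And>m. norm (\<alpha> m) \<le> 1"
    and row: "\<And>p. p \<in> P \<Longrightarrow> (\<Sum>p'\<in>P. norm (expsum (\<lambda>_. 1) t (x p' - x p))) \<le> R"
  shows "(\<Sum>p\<in>P. norm (expsum \<alpha> t (x p))) \<le> sqrt (real t * (real (card P) * R))"
proof -
  define u where "u p = cnj (sgn (expsum \<alpha> t (x p)))" for p
  define G where "G m = (\<Sum>p\<in>P. u p * cis_2pi (real m * x p))" for m
  have u: "norm (u p) \<le> 1" for p by (simp add: u_def norm_sgn)
  have polar: "complex_of_real (norm (expsum \<alpha> t (x p))) = u p * expsum \<alpha> t (x p)" for p
    using complex_norm_square[of "expsum \<alpha> t (x p)"]
    by (cases "expsum \<alpha> t (x p) = 0")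
      (simp_all add: u_def sgn_eq divide_simps power2_eq_square mult_ac)
  have "complex_of_real (\<Sum>p\<in>P. norm (expsum \<alpha> t (x p))) = (\<Sum>p\<in>P. u p * expsum \<alpha> t (x p))"
    by (simp only: of_real_sum polar)
  also have "\<dots> = (\<Sum>p\<in>P. \<Sum>m\<in>{1..t}. \<alpha> m * (u p * cis_2pi (real m * x p)))"
    by (simp only: expsum_def sum_distrib_left mult_ac)
  also have "\<dots> = (\<Sum>m\<in>{1..t}. \<alpha> m * G m)"
    by (subst sum.swap) (simp add: G_def sum_distrib_left)
  finally have "norm (complex_of_real (\<Sum>p\<in>P. norm (expsum \<alpha> t (x p))))
      \<le> (\<Sum>m\<in>{1..t}. norm (\<alpha> m * G m))"
    by (metis norm_sum)
  also have "\<dots> \<le> (\<Sum>m\<in>{1..t}. 1 * norm (G m))"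
    unfolding norm_mult by (intro sum_mono mult_right_mono \<alpha>) auto
  finally have "(\<Sum>p\<in>P. norm (expsum \<alpha> t (x p))) \<le> (\<Sum>m\<in>{1..t}. 1 * norm (G m))"
    by (simp add: sum_nonneg del: of_real_sum)
  then have "(\<Sum>p\<in>P. norm (expsum \<alpha> t (x p)))\<^sup>2 \<le> (\<Sum>m\<in>{1..t}. 1 * norm (G m))\<^sup>2"
    by (intro power_mono sum_nonneg) auto
  also have "\<dots> \<le> (\<Sum>m\<in>{1..t}. 1\<^sup>2) * (\<Sum>m\<in>{1..t}. (norm (G m))\<^sup>2)"
    by (rule Cauchy_Schwarz_ineq_sum)
  also have "\<dots> \<le> real t * (\<Sum>p\<in>P. \<Sum>p'\<in>P. norm (expsum (\<lambda>_. 1) t (x p' - x p)))"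
    unfolding G_def using sum_norm_sq_trig_poly_le[where P = P and x = x and t = t, OF u]
    by (simp add: mult_left_mono)
  also have "\<dots> \<le> real t * (\<Sum>p\<in>P. R)"
    by (intro mult_left_mono sum_mono row) auto
  finally show ?thesis by (intro real_le_rsqrt) simp
qed

lemma norm_expsum_add_le:
  "norm (expsum \<alpha> T (\<theta> + \<beta>))
    \<le> norm (expsum \<alpha> T \<theta>) + 2 * pi * \<bar>\<beta>\<bar> * (\<Sum>t<T. norm (expsum \<alpha> t \<theta>))"
proof -
  let ?e = "\<lambda>t. cis_2pi (real t * \<beta>)"
  have abel: "expsum \<alpha> T (\<theta> + \<beta>)
      = expsum \<alpha> T \<theta> * ?e T - (\<Sum>t<T. expsum \<alpha> t \<theta> * (?e (Suc t) - ?e t))"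
  proof (induction T)
    case (Suc T)
    have "cis_2pi (real (Suc T) * (\<theta> + \<beta>)) = cis_2pi (real (Suc T) * \<theta>) * ?e (Suc T)"
      by (simp only: distrib_left cis_2pi_add)
    with Suc show ?case
      by (simp add: expsum_Suc algebra_simps)
  qed (simp add: expsum_def)
  have "norm (expsum \<alpha> t \<theta> * (?e (Suc t) - ?e t)) \<le> 2 * pi * \<bar>\<beta>\<bar> * norm (expsum \<alpha> t \<theta>)" for t
  proof -
    have "?e (Suc t) - ?e t = ?e t * (cis_2pi \<beta> - 1)"
      unfolding cis_2pi_of_nat_mult by (simp add: algebra_simps)
    then show ?thesis
      using mult_right_mono[OF norm_cis_2pi_minus_1_le[of \<beta>] norm_ge_zero[of "expsum \<alpha> t \<theta>"]]
      by (simp add: norm_mult mult_ac)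
  qed
  then have "norm (\<Sum>t<T. expsum \<alpha> t \<theta> * (?e (Suc t) - ?e t))
      \<le> 2 * pi * \<bar>\<beta>\<bar> * (\<Sum>t<T. norm (expsum \<alpha> t \<theta>))"
    unfolding sum_distrib_left by (rule sum_norm_le)
  moreover have "norm (expsum \<alpha> T (\<theta> + \<beta>))
      \<le> norm (expsum \<alpha> T \<theta> * ?e T) + norm (\<Sum>t<T. expsum \<alpha> t \<theta> * (?e (Suc t) - ?e t))"
    unfolding abel by (rule norm_triangle_ineq4)
  ultimately show ?thesis by (simp add: norm_mult)
qed

lemma sum_norm_expsum_add_le:
  assumes \<beta>: "\<And>p. p \<in> P \<Longrightarrow> \<bar>\<beta> p\<bar> \<le> B"
    and Z: "\<And>t. t \<le> T \<Longrightarrow> (\<Sum>p\<in>P. norm (expsum \<alpha> t (x p))) \<le> Z"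
  shows "(\<Sum>p\<in>P. norm (expsum \<alpha> T (x p + \<beta> p))) \<le> (1 + 2 * pi * \<bar>B\<bar> * real T) * Z"
proof -
  have "(\<Sum>p\<in>P. norm (expsum \<alpha> T (x p + \<beta> p)))
      \<le> (\<Sum>p\<in>P. norm (expsum \<alpha> T (x p)) + 2 * pi * \<bar>B\<bar> * (\<Sum>t<T. norm (expsum \<alpha> t (x p))))"
  proof (rule sum_mono)
    fix p assume "p \<in> P"
    then have "2 * pi * \<bar>\<beta> p\<bar> * (\<Sum>t<T. norm (expsum \<alpha> t (x p)))
        \<le> 2 * pi * \<bar>B\<bar> * (\<Sum>t<T. norm (expsum \<alpha> t (x p)))"
      using \<beta>[of p] by (intro mult_right_mono mult_left_mono sum_nonneg) auto
    then show "norm (expsum \<alpha> T (x p + \<beta> p))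
        \<le> norm (expsum \<alpha> T (x p)) + 2 * pi * \<bar>B\<bar> * (\<Sum>t<T. norm (expsum \<alpha> t (x p)))"
      using norm_expsum_add_le[of \<alpha> T "x p" "\<beta> p"] by linarith
  qed
  also have "\<dots> = (\<Sum>p\<in>P. norm (expsum \<alpha> T (x p)))
      + 2 * pi * \<bar>B\<bar> * (\<Sum>t<T. \<Sum>p\<in>P. norm (expsum \<alpha> t (x p)))"
    by (simp add: sum.distrib sum.swap[of _ P] flip: sum_distrib_left)
  also have "\<dots> \<le> Z + 2 * pi * \<bar>B\<bar> * (\<Sum>t<T. Z)"
    using Z by (intro add_mono mult_left_mono sum_mono) auto
  finally show ?thesis by (simp add: algebra_simps)
qed

lemma dist_int_diff_fractions_ge:
  fixes u u' r r' :: int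
  assumes pos: "0 < r" "0 < r'" and cop: "coprime u r" "coprime u' r'"
    and ne: "\<not> (r = r' \<and> r dvd u - u')"
  shows "1 / (of_int r * of_int r') \<le> dist_int (of_int u / of_int r - of_int u' / of_int r')"
proof (rule dist_int_geI)
  fix k :: int
  define z where "z = u * r' - u' * r - k * r * r'"
  have "z \<noteq> 0"
  proof
    assume "z = 0"
    then have eq: "u * r' = r * (u' + k * r')" "u' * r = r' * (u - k * r)"
      by (simp_all add: z_def algebra_simps)
    have "r dvd r'" "r' dvd r"
      using eq cop by (metis coprime_commute coprime_dvd_mult_right_iff dvd_triv_left)+
    then have "r = r'" using pos by (intro zdvd_antisym_nonneg) auto
    moreover from this have "r * (u - u') = r * (r * k)" using eq(1) by (simp add: algebra_simps)
    then have "u - u' = r * k" using pos by (simp only: mult_cancel_left) simp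
    ultimately show False using ne by simp
  qed
  then have "1 \<le> \<bar>real_of_int z\<bar>" by linarith
  then have "1 / (of_int r * of_int r') \<le> \<bar>real_of_int z\<bar> / (of_int r * of_int r')"
    using pos by (intro divide_right_mono) auto
  also have "\<dots> = \<bar>of_int z / (of_int r * of_int r')\<bar>"
    using pos by (simp add: abs_mult)
  also have "of_int z / (of_int r * of_int r')
      = of_int u / of_int r - of_int u' / of_int r' - real_of_int k"
    using pos by (simp add: z_def field_simps)
  finally show "1 / (of_int r * of_int r')
      \<le> \<bar>of_int u / of_int r - of_int u' / of_int r' - real_of_int k\<bar>" .
qed

lemma dist_int_diff_multiples_of_fractions_ge:
  fixes m m' h h' y y' g :: int
  assumes g: "gcd h m = g" "gcd h' m' = g" and y: "coprime y m" "coprime y' m'"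
    and h: "0 < h" "h < m" "0 < h'" "h' < m'"
    and eq: "m = m' \<Longrightarrow> y = y'" and ne: "(m, h) \<noteq> (m', h')"
  shows "(of_int g)\<^sup>2 / (of_int m * of_int m')
    \<le> dist_int (of_int (h * y) / of_int m - of_int (h' * y') / of_int m')"
proof -
  have g0: "g > 0" using h unfolding g(1)[symmetric] by simp
  obtain a r where a: "h = g * a" "m = g * r" "coprime a r"
    using g0 unfolding g(1)[symmetric] by (metis gcd_coprime_exists mult.commute less_irrefl)
  obtain a' r' where a': "h' = g * a'" "m' = g * r'" "coprime a' r'"
    using g0 unfolding g(2)[symmetric] by (metis gcd_coprime_exists mult.commute less_irrefl)
  have pos: "0 < a" "a < r" "0 < a'" "a' < r'"
    using h g0 by (auto simp: a a' zero_less_mult_iff)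
  have "1 / (real_of_int r * of_int r')
      \<le> dist_int (of_int (a * y) / of_int r - of_int (a' * y') / of_int r')"
  proof (rule dist_int_diff_fractions_ge)
    show "coprime (a * y) r" "coprime (a' * y') r'"
      using a(3) a'(3) y by (auto simp: a(2) a'(2))
    show "\<not> (r = r' \<and> r dvd a * y - a' * y')"
    proof (rule notI, elim conjE)
      assume r: "r = r'" and "r dvd a * y - a' * y'"
      moreover have "y = y'" using eq r by (simp add: a(2) a'(2))
      ultimately have "r dvd (a - a') * y" by (simp add: left_diff_distrib)
      moreover have "coprime r y" using y(1) by (simp add: a(2) coprime_commute)
      ultimately have "r dvd a - a'" by (metis coprime_dvd_mult_left_iff)
      then have "a = a'" using zdvd_imp_le[of r "\<bar>a - a'\<bar>"] pos r by fastforce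
      then show False using ne r by (simp add: a a')
    qed
  qed (use pos in auto)
  then show ?thesis using g0 by (simp add: a a' power2_eq_square)
qed

lemma well_spaced_multiples_of_fractions:
  fixes m y :: "'a \<Rightarrow> int"
  assumes "inj_on m I" and y: "\<And>i. i \<in> I \<Longrightarrow> coprime (y i) (m i)"
    and m: "\<And>i. i \<in> I \<Longrightarrow> int K < m i" "\<And>i. i \<in> I \<Longrightarrow> real_of_int (m i) \<le> R"
  shows "well_spaced ((real g)\<^sup>2 / R\<^sup>2) (\<lambda>(i, h). real h * of_int (y i) / of_int (m i))
    {(i, h) \<in> I \<times> {1..K}. gcd (int h) (m i) = int g}"
  unfolding well_spaced_def
proof (intro ballI impI)
  fix p p'
  assume mem: "p \<in> {(i, h) \<in> I \<times> {1..K}. gcd (int h) (m i) = int g}"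
    "p' \<in> {(i, h) \<in> I \<times> {1..K}. gcd (int h) (m i) = int g}" "p \<noteq> p'"
  obtain i h i' h' where p: "p = (i, h)" "p' = (i', h')" by (cases p, cases p')
  have ih: "i \<in> I" "h \<in> {1..K}" "gcd (int h) (m i) = int g"
    "i' \<in> I" "h' \<in> {1..K}" "gcd (int h') (m i') = int g"
    and ne: "(i, h) \<noteq> (i', h')"
    using mem by (auto simp: p)
  have pos: "0 < m i" "0 < m i'" using m(1)[of i] m(1)[of i'] ih by auto
  have "(real g)\<^sup>2 / R\<^sup>2 \<le> (real g)\<^sup>2 / (of_int (m i) * of_int (m i'))"
    unfolding power2_eq_square[of R]
    using m(2)[of i] m(2)[of i'] ih pos by (intro divide_left_mono mult_mono mult_pos_pos) auto
  also have "\<dots> \<le> dist_int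
      (of_int (int h * y i) / of_int (m i) - of_int (int h' * y i') / of_int (m i'))"
    using dist_int_diff_multiples_of_fractions_ge[OF ih(3,6) y y] m(1)[of i] m(1)[of i'] ih ne
      inj_onD[OF assms(1)] by fastforce
  finally show "(real g)\<^sup>2 / R\<^sup>2 \<le> dist_int
      ((case p of (i, h) \<Rightarrow> real h * of_int (y i) / of_int (m i))
        - (case p' of (i, h) \<Rightarrow> real h * of_int (y i) / of_int (m i)))"
    by (simp add: p)
qed

lemma sum_inverse_squares_le: "(\<Sum>g\<in>{1..n}. 1 / (real g)\<^sup>2) \<le> 2"
proof -
  have "(\<Sum>g\<in>{1..n}. 1 / (real g)\<^sup>2) = (\<Sum>g<n. 1 / (real g + 1)\<^sup>2)"
    by (rule sum.reindex_bij_witness[of _ Suc "\<lambda>g. g - 1"]) auto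
  also have "\<dots> \<le> pi\<^sup>2 / 6"
    using sum_le_suminf[of "\<lambda>g. 1 / (real g + 1)\<^sup>2" "{..<n}"] inverse_squares_sums
    by (auto simp: sums_iff add.commute)
  also have "\<dots> \<le> 2"
    using power_mono[of pi "3.2" 2] pi_approx by (simp add: power2_eq_square)
  finally show ?thesis .
qed

lemma sum_norm_expsum_1_multiples_of_fractions_le:
  fixes m y :: "'a \<Rightarrow> int"
  assumes "finite I" "inj_on m I" "\<And>i. i \<in> I \<Longrightarrow> coprime (y i) (m i)"
    and m: "\<And>i. i \<in> I \<Longrightarrow> int K < m i" "\<And>i. i \<in> I \<Longrightarrow> real_of_int (m i) \<le> R"
    and R: "0 < R" and n: "R\<^sup>2 / 2 \<le> real n"
  shows "(\<Sum>(i, h)\<in>I \<times> {1..K}. norm (expsum (\<lambda>_. 1) t (real h * of_int (y i) / of_int (m i) - z)))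
    \<le> 2 * real t * real K + 2 * R\<^sup>2 * harm n"
proof -
  define P where "P = I \<times> {1..K}"
  define x where "x = (\<lambda>(i, h). real h * of_int (y i) / of_int (m i))"
  define gcd_of where "gcd_of p = nat (gcd (int (snd p)) (m (fst p)))" for p :: "'a \<times> nat"
  define gcd_class where "gcd_class g = {(i, h) \<in> I \<times> {1..K}. gcd (int h) (m i) = int g}" for g
  have gcd_class_eq: "gcd_class g = {p \<in> P. gcd_of p = g}" for g
    by (auto simp: gcd_class_def gcd_of_def P_def)
  have "gcd_of ` P \<subseteq> {1..K}"
  proof safe
    fix i h assume "(i, h) \<in> P"
    then have h: "0 < h" "h \<le> K" by (auto simp: P_def)
    have "gcd (int h) (m i) \<le> int h" "0 < gcd (int h) (m i)"
      using h by (auto intro: gcd_le1_int)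
    then show "gcd_of (i, h) \<in> {1..K}" using h
      unfolding gcd_of_def fst_conv snd_conv atLeastAtMost_iff by linarith
  qed
  then have "(\<Sum>p\<in>P. norm (expsum (\<lambda>_. 1) t (x p - z)))
      = (\<Sum>g\<in>{1..K}. \<Sum>p\<in>gcd_class g. norm (expsum (\<lambda>_. 1) t (x p - z)))"
    unfolding gcd_class_eq using assms(1) by (intro sum.group[symmetric]) (auto simp: P_def)
  also have "\<dots> \<le> (\<Sum>g\<in>{1..K}. 2 * real t + harm n / ((real g)\<^sup>2 / R\<^sup>2))"
  proof (intro sum_mono sum_norm_expsum_1_le)
    fix g assume "g \<in> {1..K}"
    then have g: "0 < g" "1 \<le> (real g)\<^sup>2" by simp_all
    then have "R\<^sup>2 / (2 * (real g)\<^sup>2) \<le> R\<^sup>2 / 2"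
      by (intro divide_left_mono) auto
    then show "1 / (2 * ((real g)\<^sup>2 / R\<^sup>2)) \<le> real n" using n by simp
    show "0 < (real g)\<^sup>2 / R\<^sup>2" using g R by simp
    show "well_spaced ((real g)\<^sup>2 / R\<^sup>2) x (gcd_class g)"
      unfolding x_def gcd_class_def using assms by (intro well_spaced_multiples_of_fractions) auto
  qed (use assms(1) in \<open>simp add: gcd_class_eq P_def\<close>)
  also have "\<dots> = 2 * real t * real K + R\<^sup>2 * harm n * (\<Sum>g\<in>{1..K}. 1 / (real g)\<^sup>2)"
    by (simp add: sum.distrib sum_distrib_left mult_ac)
  also have "\<dots> \<le> 2 * real t * real K + R\<^sup>2 * harm n * 2"
    by (intro add_left_mono mult_left_mono sum_inverse_squares_le) (simp add: harm_nonneg)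
  finally show ?thesis by (simp add: P_def x_def case_prod_unfold)
qed

lemma large_sieve_multiples_of_fractions:
  fixes m y :: "'a \<Rightarrow> int"
  assumes "finite I" "inj_on m I" "\<And>i. i \<in> I \<Longrightarrow> coprime (y i) (m i)"
    and "\<And>i. i \<in> I \<Longrightarrow> int K < m i" "\<And>i. i \<in> I \<Longrightarrow> real_of_int (m i) \<le> R"
    and "0 < R" "R\<^sup>2 / 2 \<le> real n" and \<alpha>: "\<And>m. norm (\<alpha> m) \<le> 1"
  shows "(\<Sum>(i, h)\<in>I \<times> {1..K}. norm (expsum \<alpha> t (real h * of_int (y i) / of_int (m i))))
    \<le> sqrt (real t * (real (card I) * real K * (2 * real t * real K + 2 * R\<^sup>2 * harm n)))"
proof -
  let ?x = "\<lambda>(i, h). real h * of_int (y i) / of_int (m i)"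
  have "(\<Sum>p\<in>I \<times> {1..K}. norm (expsum \<alpha> t (?x p)))
      \<le> sqrt (real t * (real (card (I \<times> {1..K})) * (2 * real t * real K + 2 * R\<^sup>2 * harm n)))"
    using sum_norm_expsum_1_multiples_of_fractions_le[OF assms(1-7)]
    by (intro sum_norm_expsum_le_of_row_sums \<alpha>) (simp add: case_prod_unfold)
  then show ?thesis
    by (simp add: card_cartesian_product case_prod_unfold)
qed

section \<open>Twisted sums of a smooth weight\<close>

lemma norm_diff_le_of_vector_derivative_unit_interval:
  fixes f :: "real \<Rightarrow> 'a::real_normed_vector"
  assumes "\<And>x. x \<in> {0..1} \<Longrightarrow> (f has_vector_derivative f' x) (at x within {0..1})"
    "\<And>x. x \<in> {0..1} \<Longrightarrow> norm (f' x) \<le> B" "x \<in> {0..1}" "y \<in> {0..1}"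
  shows "norm (f x - f y) \<le> B"
proof -
  have "norm (f x - f y) \<le> B * norm (x - y)"
  proof (rule differentiable_bound[OF _ _ _ assms(3,4)])
    show "(f has_derivative (\<lambda>h. h *\<^sub>R f' x)) (at x within {0..1})" if "x \<in> {0..1}" for x
      using assms(1)[OF that] by (simp add: has_vector_derivative_def)
    show "onorm (\<lambda>h. h *\<^sub>R f' x) \<le> B" if "x \<in> {0..1}" for x
      using assms(2)[OF that] by (intro onorm_le) (simp add: mult.commute[of B] mult_left_mono)
  qed simp
  also have "\<dots> \<le> B * 1"
    using assms(3,4) order_trans[OF norm_ge_zero assms(2)[OF assms(3)]]
    by (intro mult_left_mono) auto
  finally show ?thesis by simp
qed

lemma norm_quasi_periodic_le:
  fixes f :: "real \<Rightarrow> 'a::real_normed_field"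
  assumes deriv: "\<And>x. x \<in> {0..1} \<Longrightarrow> (f has_vector_derivative f' x) (at x within {0..1})"
    and B: "\<And>x. x \<in> {0..1} \<Longrightarrow> norm (f' x) \<le> B"
    and "f 1 = \<zeta> * f 0" "norm \<zeta> = 1" "x \<in> {0..1}"
  shows "norm (f x) * norm (\<zeta> - 1) \<le> 3 * B"
proof -
  have osc: "norm (f a - f b) \<le> B" if "a \<in> {0..1}" "b \<in> {0..1}" for a b
    by (rule norm_diff_le_of_vector_derivative_unit_interval[OF deriv B that])
  have "f x * (\<zeta> - 1) = (f x - f 0) * (\<zeta> - 1) + (f 1 - f 0)"
    by (simp add: assms(3) algebra_simps)
  then have "norm (f x) * norm (\<zeta> - 1) \<le> norm (f x - f 0) * norm (\<zeta> - 1) + norm (f 1 - f 0)"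
    by (metis norm_mult norm_triangle_ineq)
  also have "\<dots> \<le> B * 2 + B"
    using osc[OF assms(5)] osc norm_triangle_ineq4[of \<zeta> 1] assms(4)
      order_trans[OF norm_ge_zero B[of 0]]
    by (intro add_mono mult_mono) auto
  finally show ?thesis by simp
qed

lemma norm_increment_minus_derivative_le:
  fixes f :: "real \<Rightarrow> 'a::real_normed_vector"
  assumes f: "\<And>x. x \<in> {0..1} \<Longrightarrow> (f has_vector_derivative f' x) (at x within {0..1})"
    and f': "\<And>x. x \<in> {0..1} \<Longrightarrow> (f' has_vector_derivative f'' x) (at x within {0..1})"
    and B: "\<And>x. x \<in> {0..1} \<Longrightarrow> norm (f'' x) \<le> B" and x: "x \<in> {0..1}"
  shows "norm (f 1 - f 0 - f' x) \<le> B"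
proof -
  have "norm (f 1 - f 0 - (1 - 0) *\<^sub>R f' x) \<le> norm (1 - 0 :: real) * B"
    using norm_diff_le_of_vector_derivative_unit_interval[OF f' B _ x] f x
    by (intro vector_differentiable_bound_linearization[where S = "{0..1}"])
      (auto simp: closed_segment_eq_real_ivl)
  then show ?thesis by simp
qed

locale smooth_weight =
  fixes W :: "real \<Rightarrow> real"
  assumes smooth: "smooth W" and support: "closure {t. W t \<noteq> 0} \<subseteq> {0..1}"
begin

definition nth_deriv :: "nat \<Rightarrow> real \<Rightarrow> real" where
  "nth_deriv k = (deriv ^^ k) W"

lemma nth_deriv_0 [simp]: "nth_deriv 0 = W"
  by (simp add: nth_deriv_def)

lemma has_nth_deriv: "(nth_deriv k has_real_derivative nth_deriv (Suc k) t) (at t)"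
proof -
  have "nth_deriv k differentiable (at t)"
    using smooth unfolding smooth_def differentiable_on_def nth_deriv_def by simp
  then show ?thesis
    by (simp add: nth_deriv_def DERIV_deriv_iff_real_differentiable)
qed

lemma continuous_nth_deriv: "continuous_on S (nth_deriv k)"
  by (meson DERIV_isCont continuous_at_imp_continuous_on has_nth_deriv)

lemma nth_deriv_eq_0:
  assumes "t \<notin> {0<..<1}"
  shows "nth_deriv k t = 0"
proof -
  have outside: "nth_deriv k t = 0" if "t \<notin> {0..1}" for t
    using that
  proof (induction k arbitrary: t)
    case 0
    then show ?case using support closure_subset[of "{t. W t \<noteq> 0}"] by auto
  next
    case (Suc k)
    have "(nth_deriv k has_real_derivative 0) (at t)"
      by (rule has_field_derivative_transform_within_open[of "\<lambda>_. 0" _ _ "- {0..1}"])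
        (use Suc in auto)
    then show ?case using has_nth_deriv DERIV_unique by blast
  qed
  show ?thesis
  proof (rule continuous_constant_on_closure[OF continuous_nth_deriv outside])
    show "t \<in> closure (- {0..1})"
      using assms by (simp add: closure_complement interior_atLeastAtMost_real)
  qed simp
qed

definition deriv_sup :: "nat \<Rightarrow> real" where
  "deriv_sup k = (SUP t. \<bar>nth_deriv k t\<bar>)"

lemma abs_nth_deriv_le: "\<bar>nth_deriv k t\<bar> \<le> deriv_sup k"
proof -
  have "bounded (nth_deriv k ` {0..1})"
    by (intro compact_imp_bounded compact_continuous_image continuous_nth_deriv compact_Icc)
  then obtain C where C: "C > 0" "\<And>t. t \<in> {0..1} \<Longrightarrow> \<bar>nth_deriv k t\<bar> \<le> C"
    unfolding bounded_pos by auto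
  then have "\<bar>nth_deriv k t\<bar> \<le> C" for t
    using nth_deriv_eq_0[of t k] by (cases "t \<in> {0..1}") auto
  then have "bdd_above (range (\<lambda>t. \<bar>nth_deriv k t\<bar>))" by (rule bdd_aboveI2)
  then show ?thesis unfolding deriv_sup_def by (intro cSUP_upper) auto
qed

lemma deriv_sup_nonneg: "0 \<le> deriv_sup k"
  using abs_nth_deriv_le[of k 0] by linarith

text \<open>Since \<open>W\<close> also vanishes at 0 and 1, the range \<open>n \<le> X\<close> contains all nonzero terms for every
  \<open>x\<close> between 0 and 1.\<close>

definition twisted_sum :: "nat \<Rightarrow> real \<Rightarrow> real \<Rightarrow> real \<Rightarrow> complex" where
  "twisted_sum k X \<theta> x =
     (\<Sum>n\<le>nat \<lfloor>X\<rfloor>. of_real (nth_deriv k ((real n + x) / X)) * cis_2pi (- (\<theta> * real n)))"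

lemma twisted_sum_add_of_int: "twisted_sum k X (\<theta> + of_int j) x = twisted_sum k X \<theta> x"
proof -
  have "cis_2pi (- ((\<theta> + of_int j) * real n)) = cis_2pi (- (\<theta> * real n))" for n
    using cis_2pi_add_of_int[of "- (\<theta> * real n)" "- j * int n"] by (simp add: algebra_simps)
  then show ?thesis by (simp add: twisted_sum_def)
qed

lemma norm_twisted_sum_le:
  assumes "1 \<le> X"
  shows "norm (twisted_sum k X \<theta> x) \<le> 2 * X * deriv_sup k"
proof -
  have "norm (twisted_sum k X \<theta> x) \<le> (\<Sum>n\<le>nat \<lfloor>X\<rfloor>. deriv_sup k)"
    unfolding twisted_sum_def
    by (rule sum_norm_le) (simp add: norm_mult abs_nth_deriv_le)
  also have "\<dots> = (real (nat \<lfloor>X\<rfloor>) + 1) * deriv_sup k" by simp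
  also have "\<dots> \<le> 2 * X * deriv_sup k"
    using assms by (intro mult_right_mono deriv_sup_nonneg) linarith
  finally show ?thesis .
qed

lemma has_vector_derivative_twisted_sum:
  assumes "X > 0"
  shows "(twisted_sum k X \<theta> has_vector_derivative twisted_sum (Suc k) X \<theta> x / of_real X)
    (at x within S)"
proof -
  have "((\<lambda>x. nth_deriv k ((real n + x) / X)) has_real_derivative
      nth_deriv (Suc k) ((real n + x) / X) * (1 / X)) (at x within S)" for n
    using assms by (intro DERIV_chain2[OF has_nth_deriv]) (auto intro!: derivative_eq_intros)
  then have "((\<lambda>x. of_real (nth_deriv k ((real n + x) / X)) * cis_2pi (- (\<theta> * real n)))
      has_vector_derivative
      of_real (nth_deriv (Suc k) ((real n + x) / X) * (1 / X)) * cis_2pi (- (\<theta> * real n)))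
      (at x within S)" for n
    by (intro has_vector_derivative_mult_left has_vector_derivative_of_real)
      (simp add: has_real_derivative_iff_has_vector_derivative)
  then have "(twisted_sum k X \<theta> has_vector_derivative
      (\<Sum>n\<le>nat \<lfloor>X\<rfloor>.
        of_real (nth_deriv (Suc k) ((real n + x) / X) * (1 / X)) * cis_2pi (- (\<theta> * real n))))
      (at x within S)"
    unfolding twisted_sum_def by (intro has_vector_derivative_sum) auto
  then show ?thesis by (simp add: twisted_sum_def sum_divide_distrib)
qed

lemma twisted_sum_1:
  assumes "X > 0"
  shows "twisted_sum k X \<theta> 1 = cis_2pi \<theta> * twisted_sum k X \<theta> 0"
proof -
  define g where "g n = of_real (nth_deriv k (real n / X)) * cis_2pi (- (\<theta> * real n))" for n
  have "1 \<le> real (Suc (nat \<lfloor>X\<rfloor>)) / X"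
    using assms by (simp add: field_simps; linarith)
  then have ends: "g 0 = 0" "g (Suc (nat \<lfloor>X\<rfloor>)) = 0"
    using assms by (simp_all add: g_def nth_deriv_eq_0 del: of_nat_Suc)
  have "twisted_sum k X \<theta> 1 = (\<Sum>n\<le>nat \<lfloor>X\<rfloor>. cis_2pi \<theta> * g (Suc n))"
    unfolding twisted_sum_def g_def
    by (intro sum.cong refl) (simp add: algebra_simps flip: cis_2pi_add)
  also have "\<dots> = cis_2pi \<theta> * (\<Sum>n\<le>nat \<lfloor>X\<rfloor>. g n)"
    using sum.atMost_Suc_shift[of g "nat \<lfloor>X\<rfloor>"] ends by (simp flip: sum_distrib_left)
  finally show ?thesis by (simp add: twisted_sum_def g_def)
qed

lemma twisted_sum_decay:
  assumes X: "1 \<le> X" and x: "x \<in> {0..1}"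
  shows "norm (twisted_sum k X \<theta> x) * (X * norm (cis_2pi \<theta> - 1)) ^ j
    \<le> 3 ^ j * (2 * X * deriv_sup (k + j))"
  using x
proof (induction j arbitrary: k x)
  case 0
  then show ?case using norm_twisted_sum_le[OF X] by simp
next
  case (Suc j)
  define r where "r = X * norm (cis_2pi \<theta> - 1)"
  define C where "C = 3 ^ j * (2 * X * deriv_sup (k + Suc j))"
  let ?f = "\<lambda>i x. of_real (r ^ j) * twisted_sum i X \<theta> x"
  have norm_f: "norm (?f i x) = r ^ j * norm (twisted_sum i X \<theta> x)" for i x
    using X by (simp add: r_def norm_mult flip: of_real_power)
  have "norm (?f k x) * norm (cis_2pi \<theta> - 1) \<le> 3 * (C / X)"
  proof (rule norm_quasi_periodic_le[OF _ _ _ norm_cis_2pi Suc.prems])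
    show "(?f k has_vector_derivative ?f (Suc k) z / of_real X) (at z within {0..1})" for z
      using has_vector_derivative_mult_right[OF has_vector_derivative_twisted_sum] X by fastforce
    show "norm (?f (Suc k) z / of_real X) \<le> C / X" if "z \<in> {0..1}" for z
      using Suc.IH[OF that, of "Suc k"] X unfolding norm_divide norm_f
      by (simp add: r_def C_def field_simps)
    show "?f k 1 = cis_2pi \<theta> * ?f k 0"
      using twisted_sum_1[of X k \<theta>] X by simp
  qed
  then have "X * (norm (?f k x) * norm (cis_2pi \<theta> - 1)) \<le> X * (3 * (C / X))"
    using X by (intro mult_left_mono) auto
  then show ?case
    using X unfolding norm_f by (simp add: r_def C_def mult_ac)
qed

lemma norm_twisted_sum_0_Suc_le:
  assumes X: "1 \<le> X" and "x \<in> {0..1}"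
  shows "norm (twisted_sum (Suc k) X 0 x) \<le> 2 * X * deriv_sup (Suc k + j) / X ^ j"
  using assms(2)
proof (induction j arbitrary: k x)
  case 0
  then show ?case using norm_twisted_sum_le[OF X] by simp
next
  case (Suc j)
  define C where "C = 2 * X * deriv_sup (Suc k + Suc j)"
  have X0: "X > 0" using X by simp
  have "norm (twisted_sum k X 0 1 - twisted_sum k X 0 0 - twisted_sum (Suc k) X 0 x / of_real X)
      \<le> C / X ^ j / X / X"
  proof (rule norm_increment_minus_derivative_le[OF _ _ _ Suc.prems])
    show "norm (twisted_sum (Suc (Suc k)) X 0 z / of_real X / of_real X) \<le> C / X ^ j / X / X"
      if "z \<in> {0..1}" for z
      using Suc.IH[OF that, of "Suc k"] X0
      unfolding norm_divide norm_of_real abs_of_pos[OF X0]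
      by (intro divide_right_mono) (simp_all add: C_def)
  qed (intro has_vector_derivative_divide has_vector_derivative_twisted_sum X0)+
  then have "norm (twisted_sum (Suc k) X 0 x) / X \<le> C / X ^ j / X / X"
    using twisted_sum_1[OF X0, of k 0] X0 by (simp add: norm_divide)
  then show ?case using X0 by (simp add: C_def field_simps)
qed

definition primitive_sum :: "real \<Rightarrow> real \<Rightarrow> complex" where
  "primitive_sum X x = of_real X * (\<Sum>n\<le>nat \<lfloor>X\<rfloor>. of_real (integral {0..(real n + x) / X} W))"

lemma has_vector_derivative_primitive_sum:
  assumes X: "1 \<le> X" and z: "z \<in> {0..1}"
  shows "(primitive_sum X has_vector_derivative twisted_sum 0 X 0 z) (at z within {0..1})"
proof -
  let ?V = "\<lambda>t. integral {0..t} W"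
  have cont: "continuous_on S W" for S using continuous_nth_deriv[of S 0] by simp
  have "((\<lambda>x. ?V ((real n + x) / X)) has_vector_derivative W ((real n + z) / X) * (1 / X))
      (at z within {0..1})"
    if "n \<le> nat \<lfloor>X\<rfloor>" for n
  proof -
    have inside: "(real n + x) / X \<in> {0..2}" if "x \<in> {0..1}" for x
      using that \<open>n \<le> nat \<lfloor>X\<rfloor>\<close> X by (simp add: field_simps; linarith)
    have "((\<lambda>x. (real n + x) / X) has_vector_derivative 1 / X) (at z within {0..1})"
      using X by (auto intro!: derivative_eq_intros)
    moreover have "(?V has_vector_derivative W ((real n + z) / X))
        (at ((real n + z) / X) within (\<lambda>x. (real n + x) / X) ` {0..1})"
      by (rule has_vector_derivative_within_subset
          [OF integral_has_vector_derivative[OF cont inside[OF z]]])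
        (use inside in auto)
    ultimately show ?thesis
      using vector_diff_chain_within[of "\<lambda>x. (real n + x) / X" "1 / X" z "{0..1}" ?V]
      by (simp add: o_def)
  qed
  then have "(primitive_sum X has_vector_derivative
      of_real X * (\<Sum>n\<le>nat \<lfloor>X\<rfloor>. of_real (W ((real n + z) / X) * (1 / X)))) (at z within {0..1})"
    unfolding primitive_sum_def
    by (intro has_vector_derivative_mult_right has_vector_derivative_sum
        has_vector_derivative_of_real)
      (auto simp: has_real_derivative_iff_has_vector_derivative)
  then show ?thesis using X by (simp add: twisted_sum_def sum_distrib_left)
qed

lemma primitive_sum_increment:
  assumes "X > 0"
  shows "primitive_sum X 1 - primitive_sum X 0 = of_real (X * integral UNIV W)"
proof -
  let ?K = "Suc (nat \<lfloor>X\<rfloor>)"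
  have "primitive_sum X 1 - primitive_sum X 0
      = of_real (X * (integral {0..real ?K / X} W - integral {0..0} W))"
    using sum_lessThan_telescope[of "\<lambda>n. integral {0..real n / X} W" ?K]
    by (simp add: primitive_sum_def lessThan_Suc_atMost add.commute
        flip: right_diff_distrib sum_subtractf of_real_diff of_real_sum)
  moreover have "integral {0..real ?K / X} W = integral UNIV W"
  proof -
    have "1 \<le> real ?K / X" using assms by (simp add: field_simps; linarith)
    then have "W = (\<lambda>t. if t \<in> {0..real ?K / X} then W t else 0)"
      using nth_deriv_eq_0[of _ 0] by fastforce
    then show ?thesis by (metis integral_restrict_UNIV)
  qed
  ultimately show ?thesis by simp
qed

lemma twisted_sum_0_approx:
  assumes X: "1 \<le> X" and "x \<in> {0..1}"
  shows "norm (twisted_sum 0 X 0 x - of_real (X * integral UNIV W))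
    \<le> 2 * X * deriv_sup (Suc j) / X ^ Suc j"
proof -
  have X0: "X > 0" using X by simp
  have "norm (primitive_sum X 1 - primitive_sum X 0 - twisted_sum 0 X 0 x)
      \<le> 2 * X * deriv_sup (Suc 0 + j) / X ^ j / X"
  proof (rule norm_increment_minus_derivative_le
      [OF _ has_vector_derivative_twisted_sum[OF X0] _ assms(2)])
    show "norm (twisted_sum (Suc 0) X 0 z / of_real X) \<le> 2 * X * deriv_sup (Suc 0 + j) / X ^ j / X"
      if "z \<in> {0..1}" for z
      using norm_twisted_sum_0_Suc_le[OF X that, of 0 j] X0
      unfolding norm_divide norm_of_real abs_of_pos[OF X0] by (intro divide_right_mono) simp_all
  qed (rule has_vector_derivative_primitive_sum[OF X])
  then show ?thesis
    using X0 by (simp add: primitive_sum_increment norm_minus_commute mult_ac)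
qed

end

section \<open>Lattices as residue classes\<close>

lemma full_rank_lattice_combination:
  assumes "full_rank_lattice L" "(m, n) \<in> L" "(m', n') \<in> L"
  shows "(i * m + j * m', i * n + j * n') \<in> L"
proof -
  obtain u v where L: "L = {(a * fst u + b * fst v, a * snd u + b * snd v) | a b. True}"
    using assms(1) by (auto simp: full_rank_lattice_def lattice_basis_def)
  obtain a b a' b' where ab: "m = a * fst u + b * fst v" "n = a * snd u + b * snd v"
      "m' = a' * fst u + b' * fst v" "n' = a' * snd u + b' * snd v"
    using assms(2,3) by (auto simp: L)
  have "i * m + j * m' = (i * a + j * a') * fst u + (i * b + j * b') * fst v"
    and "i * n + j * n' = (i * a + j * a') * snd u + (i * b + j * b') * snd v"
    by (simp_all add: ab algebra_simps)
  then show ?thesis unfolding L by blast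
qed

lemma full_rank_lattice_det_pos:
  assumes "full_rank_lattice L"
  shows "0 < lattice_det L"
proof -
  obtain u v where "lattice_basis u v L" using assms by (auto simp: full_rank_lattice_def)
  then show ?thesis using lattice_det_eq[of u v L] by (simp add: lattice_basis_def)
qed

lemma euclid_len_le_iff: "euclid_len (a, b) \<le> euclid_len (c, d) \<longleftrightarrow> a\<^sup>2 + b\<^sup>2 \<le> c\<^sup>2 + d\<^sup>2"
proof -
  have "euclid_len (a, b) \<le> euclid_len (c, d) \<longleftrightarrow> real_of_int (a\<^sup>2 + b\<^sup>2) \<le> real_of_int (c\<^sup>2 + d\<^sup>2)"
    by (simp add: euclid_len_def norm_Pair)
  then show ?thesis by (simp only: of_int_le_iff)
qed

lemma reduced_basis_inner_le:
  assumes "full_rank_lattice L" "reduced_basis L (m, n) (m', n')"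
  shows "2 * \<bar>m * m' + n * n'\<bar> \<le> m\<^sup>2 + n\<^sup>2"
proof -
  note reduced = assms(2)[unfolded reduced_basis_def]
  have shorter: "m'\<^sup>2 + n'\<^sup>2 \<le> (m' + k * m)\<^sup>2 + (n' + k * n)\<^sup>2" for k
  proof -
    have "(m' + k * m, n' + k * n) \<in> L"
      using full_rank_lattice_combination[OF assms(1), of m' n' m n 1 k] reduced by simp
    moreover have "(m' + k * m, n' + k * n) \<notin> int_multiples (m, n)"
    proof
      assume "(m' + k * m, n' + k * n) \<in> int_multiples (m, n)"
      then obtain j where "m' + k * m = j * m" "n' + k * n = j * n"
        by (auto simp: int_multiples_def)
      then have "(m', n') = ((j - k) * m, (j - k) * n)" by (simp add: algebra_simps)
      then show False using reduced by (auto simp: int_multiples_def)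
    qed
    ultimately show ?thesis using reduced euclid_len_le_iff by blast
  qed
  show ?thesis
    using shorter[of 1] shorter[of "-1"] by (simp add: power2_eq_square abs_if algebra_simps)
qed

lemma reduced_basis_norm_sq_le:
  assumes "full_rank_lattice L" "reduced_basis L (m, n) b2"
  shows "m\<^sup>2 + n\<^sup>2 \<le> 2 * lattice_det L"
proof -
  obtain m' n' where b2: "b2 = (m', n')" by (cases b2)
  note reduced = assms(2)[unfolded reduced_basis_def b2]
  define A where "A = m\<^sup>2 + n\<^sup>2"
  define s where "s = m * m' + n * n'"
  have det: "m * n' - n * m' = lattice_det L" using reduced by (simp add: det2_def)
  have "(m', n') \<noteq> (0, 0)" using full_rank_lattice_det_pos[OF assms(1)] det by auto
  then have "A \<le> m'\<^sup>2 + n'\<^sup>2" unfolding A_def using reduced euclid_len_le_iff by blast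
  then have "A * A \<le> A * (m'\<^sup>2 + n'\<^sup>2)" by (intro mult_left_mono) (auto simp: A_def)
  also have "\<dots> = (lattice_det L)\<^sup>2 + s\<^sup>2"
    unfolding det[symmetric] A_def s_def by algebra
  finally have "A\<^sup>2 \<le> (lattice_det L)\<^sup>2 + s\<^sup>2" by (simp add: power2_eq_square)
  moreover have "(2 * s)\<^sup>2 \<le> A\<^sup>2"
    using reduced_basis_inner_le[OF assms[unfolded b2]]
    by (subst abs_le_square_iff[symmetric])
      (simp add: A_def s_def abs_mult del: distrib_left_numeral)
  ultimately have "A\<^sup>2 \<le> (2 * lattice_det L)\<^sup>2"
    unfolding power_mult_distrib power2_eq_square[of 2] using zero_le_power2[of A] by linarith
  then show ?thesis
    unfolding A_def by (rule power2_le_imp_le) (use full_rank_lattice_det_pos[OF assms(1)] in simp)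
qed

definition residue_lattice :: "int \<Rightarrow> int \<Rightarrow> (int \<times> int) set" where
  "residue_lattice q c = {(m, n). q dvd n - c * m}"

lemma mem_residue_lattice [simp]: "(m, n) \<in> residue_lattice q c \<longleftrightarrow> q dvd n - c * m"
  by (simp add: residue_lattice_def)

lemma lattice_det_residue_lattice:
  assumes "0 < q"
  shows "lattice_det (residue_lattice q c) = q"
proof -
  have "residue_lattice q c = {(a, a * c + b * q) | a b. True}"
    by (auto simp: residue_lattice_def dvd_def algebra_simps)
  then have "lattice_basis (1, c) (0, q) (residue_lattice q c)"
    using assms by (simp add: lattice_basis_def det2_def)
  then show ?thesis using lattice_det_eq assms by (fastforce simp: det2_def)
qed

lemma full_rank_lattice_eq_residue_lattice:
  assumes "full_rank_lattice L" "Gcd (fst ` L) = 1"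
  shows "\<exists>c. L = residue_lattice (lattice_det L) c"
proof -
  obtain u v where uv: "lattice_basis u v L" using assms(1) unfolding full_rank_lattice_def by blast
  obtain u1 u2 v1 v2 where u: "u = (u1, u2)" and v: "v = (v1, v2)" by (cases u, cases v)
  define d where "d = u1 * v2 - u2 * v1"
  have L: "L = {(a * u1 + b * v1, a * u2 + b * v2) | a b. True}"
    using uv by (auto simp: lattice_basis_def u v)
  have "gcd u1 v1 dvd Gcd (fst ` L)" by (rule Gcd_greatest) (auto simp: L)
  then have "gcd u1 v1 = 1" using assms(2) by simp
  then obtain x y where bezout: "x * u1 + y * v1 = 1" by (metis bezout_int)
  define c where "c = x * u2 + y * v2"
  have "(m, n) \<in> L \<longleftrightarrow> d dvd n - c * m" for m n
  proof
    assume "(m, n) \<in> L"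
    then obtain a b where ab: "m = a * u1 + b * v1" "n = a * u2 + b * v2" by (auto simp: L)
    have "n - c * m = n * (x * u1 + y * v1) - c * m" by (simp add: bezout)
    also have "\<dots> = d * (x * b - y * a)" by (simp add: ab c_def d_def algebra_simps)
    finally show "d dvd n - c * m" by simp
  next
    assume "d dvd n - c * m"
    then obtain t where t: "n = c * m + d * t" by (metis dvdE diff_eq_eq add.commute)
    define a b where "a = m * x - t * v1" and "b = m * y + t * u1"
    have "a * u1 + b * v1 = m * (x * u1 + y * v1)" by (simp add: a_def b_def algebra_simps)
    then have "m = a * u1 + b * v1" by (simp add: bezout)
    moreover have "n = a * u2 + b * v2" by (simp add: a_def b_def t c_def d_def algebra_simps)
    ultimately show "(m, n) \<in> L" by (auto simp: L)
  qed
  moreover have "lattice_det L = \<bar>d\<bar>" using lattice_det_eq[OF uv] by (simp add: det2_def u v d_def)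
  ultimately have "L = residue_lattice (lattice_det L) c" by auto
  then show ?thesis ..
qed

text \<open>If \<open>y\<close> and \<open>m\<close> had a common factor, dividing \<open>(m, n)\<close> by it would give a shorter lattice
  vector.\<close>

lemma reduced_basis_residue_lattice_coprime:
  assumes "reduced_basis (residue_lattice q c) (m, n) b2" and m: "m > 0"
  shows "\<exists>y. coprime y m \<and> c * m = y * q + n"
proof -
  note reduced = assms(1)[unfolded reduced_basis_def]
  have "q dvd c * m - n" using reduced by (simp add: dvd_diff_commute)
  then obtain y where y: "c * m = y * q + n" by (metis dvd_def diff_eq_eq mult.commute)
  define g where "g = gcd y m"
  have g0: "g > 0" using m by (simp add: g_def)
  obtain y1 m1 where g: "y = g * y1" "m = g * m1" unfolding g_def by (meson dvdE gcd_dvd1 gcd_dvd2)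
  define n1 where "n1 = c * m1 - y1 * q"
  have n: "n = g * n1" using y by (simp add: g n1_def algebra_simps)
  have m1: "m1 > 0" using m g g0 by (simp add: zero_less_mult_iff)
  have "(m1, n1) \<in> residue_lattice q c" by (simp add: n1_def)
  then have "m\<^sup>2 + n\<^sup>2 \<le> m1\<^sup>2 + n1\<^sup>2"
    using reduced m1 unfolding euclid_len_le_iff[symmetric] by auto
  then have "g\<^sup>2 * (m1\<^sup>2 + n1\<^sup>2) \<le> 1 * (m1\<^sup>2 + n1\<^sup>2)"
    by (simp add: g n power_mult_distrib algebra_simps)
  moreover have "m1\<^sup>2 + n1\<^sup>2 > 0" using m1 by (simp add: add_pos_nonneg)
  ultimately have "g\<^sup>2 \<le> 1" by (simp only: mult_le_cancel_right_pos)
  then have "g = 1" using g0 by (simp add: abs_square_le_1)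
  then show ?thesis using y by (auto simp: g_def coprime_iff_gcd_eq_1)
qed

section \<open>Fourier expansion of \<open>\<psi>\<close>\<close>

definition psi_error ::
  "(real \<Rightarrow> real) \<Rightarrow> real \<Rightarrow> (nat \<Rightarrow> complex) \<Rightarrow> (int \<times> int) set \<Rightarrow> real" where
  "psi_error W N \<alpha> L = norm (psi W L N \<alpha> -
     complex_of_real (N * integral UNIV W / real_of_int (lattice_det L)) *
     (\<Sum>m\<in>{m::nat. 1 \<le> m \<and> real m \<le> N}. \<alpha> m))"

definition expsum_multiples :: "(nat \<Rightarrow> complex) \<Rightarrow> nat \<Rightarrow> nat \<Rightarrow> real \<Rightarrow> real" where
  "expsum_multiples \<alpha> t K \<theta> = (\<Sum>h\<in>{1..K}. norm (expsum \<alpha> t (real h * \<theta>)))"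

lemma expsum_multiples_nonneg: "0 \<le> expsum_multiples \<alpha> t K \<theta>"
  by (simp add: expsum_multiples_def sum_nonneg)

lemma sum_low_high_frequencies_le:
  fixes f :: "int \<Rightarrow> real"
  assumes nonneg: "\<And>h. 0 \<le> f h" and periodic: "\<And>h. f (h - int q) = f h" and "0 \<le> E"
    and middle: "\<And>h. K < h \<Longrightarrow> h + K < q \<Longrightarrow> f (int h) \<le> E"
  shows "(\<Sum>h\<in>{1..<q}. f (int h)) \<le> (\<Sum>h\<in>{1..K}. f (int h)) + (\<Sum>h\<in>{1..K}. f (- int h)) + real q * E"
proof -
  have truncate: "(\<Sum>h\<in>{1..<q}. if h \<le> K then g h else 0) \<le> (\<Sum>h\<in>{1..K}. g h)"
    if "\<And>h. 0 \<le> g h" for g :: "nat \<Rightarrow> real"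
  proof -
    have "(\<Sum>h\<in>{1..<q}. if h \<le> K then g h else 0) = (\<Sum>h\<in>{h\<in>{1..<q}. h \<le> K}. g h)"
      by (rule sum.inter_filter[symmetric]) simp
    also have "\<dots> \<le> (\<Sum>h\<in>{1..K}. g h)" using that by (intro sum_mono2) auto
    finally show ?thesis .
  qed
  have "f (int h) \<le> (if h \<le> K then f (int h) else 0)
      + (if q - h \<le> K then f (- int (q - h)) else 0) + E"
    if "h \<in> {1..<q}" for h
  proof -
    have "f (- int (q - h)) = f (int h)" using periodic[of "int h"] that by (simp add: of_nat_diff)
    then show ?thesis using nonneg[of "int h"] middle[of h] \<open>0 \<le> E\<close> that by auto
  qed
  then have "(\<Sum>h\<in>{1..<q}. f (int h)) \<le> (\<Sum>h\<in>{1..<q}. (if h \<le> K then f (int h) else 0)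
      + (if q - h \<le> K then f (- int (q - h)) else 0) + E)"
    by (rule sum_mono)
  also have "\<dots> = (\<Sum>h\<in>{1..<q}. if h \<le> K then f (int h) else 0)
      + (\<Sum>h\<in>{1..<q}. if q - h \<le> K then f (- int (q - h)) else 0) + real (q - 1) * E"
    by (simp add: sum.distrib)
  also have "(\<Sum>h\<in>{1..<q}. if q - h \<le> K then f (- int (q - h)) else 0)
      = (\<Sum>h\<in>{1..<q}. if h \<le> K then f (- int h) else 0)"
    by (rule sum.reindex_bij_witness[of _ "\<lambda>h. q - h" "\<lambda>h. q - h"]) auto
  also have "(\<Sum>h\<in>{1..<q}. if h \<le> K then f (int h) else 0)
      + (\<Sum>h\<in>{1..<q}. if h \<le> K then f (- int h) else 0) + real (q - 1) * E
      \<le> (\<Sum>h\<in>{1..K}. f (int h)) + (\<Sum>h\<in>{1..K}. f (- int h)) + real q * E"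
    using nonneg \<open>0 \<le> E\<close> by (intro add_mono truncate mult_right_mono) auto
  finally show ?thesis .
qed

lemma dist_int_middle_fraction_ge:
  assumes "K < h" "h + K < q"
  shows "(real K + 1) / real q \<le> dist_int (real h / real q)"
proof (rule dist_int_geI)
  fix j :: int
  have "int K + 1 \<le> \<bar>int h - j * int q\<bar>"
  proof (cases "j \<le> 0")
    case True
    then have "j * int q \<le> 0" by (simp add: mult_nonpos_nonneg)
    then show ?thesis using assms by linarith
  next
    case False
    then have "1 * int q \<le> j * int q" by (intro mult_right_mono) auto
    then show ?thesis using assms by linarith
  qed
  then have "real_of_int (int K + 1) \<le> real_of_int \<bar>int h - j * int q\<bar>"
    by (simp only: of_int_le_iff)
  then have "real K + 1 \<le> \<bar>real h - of_int j * real q\<bar>" by simp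
  then have "(real K + 1) / real q \<le> \<bar>real h - of_int j * real q\<bar> / \<bar>real q\<bar>"
    by (simp add: divide_right_mono)
  also have "\<dots> = \<bar>(real h - of_int j * real q) / real q\<bar>"
    by (simp only: abs_divide)
  also have "(real h - of_int j * real q) / real q = real h / real q - of_int j"
    using assms by (simp add: diff_divide_distrib)
  finally show "(real K + 1) / real q \<le> \<bar>real h / real q - of_int j\<bar>" .
qed

lemma norm_expsum_floor_le:
  assumes "1 \<le> N" and "\<And>m. norm (\<alpha> m) \<le> 1"
  shows "norm (expsum \<alpha> (nat \<lfloor>N\<rfloor>) \<theta>) \<le> N"
proof -
  have "real (nat \<lfloor>N\<rfloor>) \<le> N" using assms(1) by simp
  then show ?thesis by (intro order_trans[OF norm_expsum_le[OF assms(2)]])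
qed

context smooth_weight
begin

lemma psi_eq_sum:
  assumes N: "N > 0"
  shows "psi W L N \<alpha> = (\<Sum>m\<in>{1..nat \<lfloor>N\<rfloor>}. \<Sum>n\<le>nat \<lfloor>N\<rfloor>.
    if (int m, int n) \<in> L then \<alpha> m * complex_of_real (W (real n / N)) else 0)"
proof -
  let ?f = "\<lambda>(m, n). \<alpha> (nat m) * complex_of_real (W (real_of_int n / N))"
  let ?int = "\<lambda>(m, n). (int m, int n)"
  let ?P = "{p \<in> {1..nat \<lfloor>N\<rfloor>} \<times> {..nat \<lfloor>N\<rfloor>}. ?int p \<in> L}"
  have "psi W L N \<alpha> = infsum ?f (?int ` ?P)"
    unfolding psi_def
  proof (rule infsum_cong_neutral)
    fix p assume "p \<in> ?int ` ?P - {(m, n). (m, n) \<in> L \<and> 0 < m \<and> of_int m \<le> N}"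
    then show "?f p = 0" using N by (auto simp: le_nat_iff le_floor_iff)
  next
    fix p assume mem: "p \<in> {(m, n). (m, n) \<in> L \<and> 0 < m \<and> of_int m \<le> N} - ?int ` ?P"
    obtain m n where p: "p = (m, n)" by (cases p)
    have "\<not> (0 \<le> n \<and> n \<le> \<lfloor>N\<rfloor>)"
    proof
      assume "0 \<le> n \<and> n \<le> \<lfloor>N\<rfloor>"
      then have "(nat m, nat n) \<in> ?P" "p = ?int (nat m, nat n)"
        using mem by (auto simp: p le_floor_iff nat_le_iff)
      then show False using mem by blast
    qed
    then have "of_int n / N \<notin> {0<..<1}" using N by (auto simp: le_floor_iff field_simps)
    then show "?f p = 0" using nth_deriv_eq_0[of _ 0] by (simp add: p)
  qed auto
  also have "\<dots> = (\<Sum>p\<in>?P. \<alpha> (fst p) * complex_of_real (W (real (snd p) / N)))"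
    by (simp add: sum.reindex inj_on_def case_prod_unfold)
  also have "\<dots> = (\<Sum>p\<in>{1..nat \<lfloor>N\<rfloor>} \<times> {..nat \<lfloor>N\<rfloor>}.
      if ?int p \<in> L then \<alpha> (fst p) * complex_of_real (W (real (snd p) / N)) else 0)"
    by (rule sum.inter_filter) simp
  finally show ?thesis by (simp add: sum.cartesian_product case_prod_unfold)
qed

definition fourier_term :: "(nat \<Rightarrow> complex) \<Rightarrow> real \<Rightarrow> nat \<Rightarrow> int \<Rightarrow> int \<Rightarrow> complex" where
  "fourier_term \<alpha> N q c h =
     expsum \<alpha> (nat \<lfloor>N\<rfloor>) (of_int h * (of_int c / real q)) * twisted_sum 0 N (of_int h / real q) 0"

lemma psi_residue_lattice_eq:
  assumes q: "q > 0" and N: "N > 0"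
  shows "psi W (residue_lattice (int q) c) N \<alpha> = (\<Sum>h<q. fourier_term \<alpha> N q c (int h)) / of_nat q"
proof -
  define T where "T = nat \<lfloor>N\<rfloor>"
  define e where "e m n h = cis_2pi (real m * (real h * (of_int c / real q)))
      * cis_2pi (- (real h / real q * real n))" for m n h :: nat
  let ?W = "\<lambda>n. complex_of_real (W (real n / N))"
  have detect: "of_nat q * (if int q dvd int n - c * int m then z else 0) = (\<Sum>h<q. z * e m n h)"
    for m n z
  proof -
    have "e m n h = cis_2pi (real h * (of_int (c * int m - int n) / real q))" for h
      using q unfolding e_def cis_2pi_add[symmetric]
      by (intro arg_cong[where f = cis_2pi]) (simp add: field_simps)
    then have "(\<Sum>h<q. z * e m n h) = z * (if int q dvd c * int m - int n then of_nat q else 0)"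
      by (simp only: sum_cis_2pi_residues[OF q] flip: sum_distrib_left)
    then show ?thesis
      using dvd_diff_commute[of "int q" "int n" "c * int m"] by simp
  qed
  have "of_nat q * psi W (residue_lattice (int q) c) N \<alpha>
      = (\<Sum>m\<in>{1..T}. \<Sum>n\<le>T. \<Sum>h<q. \<alpha> m * ?W n * e m n h)"
    unfolding psi_eq_sum[OF N] sum_distrib_left mem_residue_lattice detect T_def ..
  also have "\<dots> = (\<Sum>h<q. \<Sum>m\<in>{1..T}. \<Sum>n\<le>T. \<alpha> m * ?W n * e m n h)"
    by (simp only: sum.swap[of _ "{..<q}"])
  also have "\<dots> = (\<Sum>h<q. fourier_term \<alpha> N q c (int h))"
    unfolding fourier_term_def expsum_def twisted_sum_def sum_product nth_deriv_0 add_0_right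
      T_def e_def of_int_of_nat_eq
    by (intro sum.cong refl) (simp only: mult_ac)
  finally show ?thesis
    using q by (subst nonzero_eq_divide_eq) (simp_all add: mult.commute)
qed

lemma fourier_term_0:
  "fourier_term \<alpha> N q c 0 = (\<Sum>m\<in>{1..nat \<lfloor>N\<rfloor>}. \<alpha> m) * twisted_sum 0 N 0 0"
  by (simp add: fourier_term_def expsum_def)

lemma fourier_term_diff_modulus:
  assumes "q > 0"
  shows "fourier_term \<alpha> N q c (h - int q) = fourier_term \<alpha> N q c h"
proof -
  have "of_int (h - int q) * (of_int c / real q) = of_int h * (of_int c / real q) + of_int (- c)"
    "of_int (h - int q) / real q = of_int h / real q + of_int (- 1)"
    using assms by (simp_all add: field_simps)
  then show ?thesis
    unfolding fourier_term_def by (simp only: expsum_add_of_int twisted_sum_add_of_int)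
qed

lemma norm_fourier_term_le:
  assumes "1 \<le> N"
  shows "norm (fourier_term \<alpha> N q c h)
    \<le> 2 * N * deriv_sup 0 * norm (expsum \<alpha> (nat \<lfloor>N\<rfloor>) (of_int h * (of_int c / real q)))"
  unfolding fourier_term_def norm_mult
  by (subst mult.commute) (intro mult_right_mono norm_twisted_sum_le assms norm_ge_zero)

lemma norm_fourier_term_middle_le:
  assumes N: "1 \<le> N" and \<alpha>: "\<And>m. norm (\<alpha> m) \<le> 1" and h: "K < h" "h + K < q"
    and \<rho>: "0 < \<rho>" "\<rho> \<le> 4 * N * (real K + 1) / real q"
  shows "norm (fourier_term \<alpha> N q c (int h)) \<le> N * (3 ^ k * (2 * N * deriv_sup k) / \<rho> ^ k)"
proof -
  let ?S = "twisted_sum 0 N (real h / real q) 0" and ?d = "norm (cis_2pi (real h / real q) - 1)"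
  have "4 * ((real K + 1) / real q) \<le> ?d"
    using dist_int_middle_fraction_ge[OF h] norm_cis_2pi_minus_1_ge[of "real h / real q"]
    by linarith
  then have "N * (4 * ((real K + 1) / real q)) \<le> N * ?d"
    using N by (intro mult_left_mono) auto
  then have "\<rho> \<le> N * ?d"
    using \<rho>(2) by (simp add: mult_ac)
  then have "norm ?S * \<rho> ^ k \<le> norm ?S * (N * ?d) ^ k"
    using \<rho>(1) by (intro mult_left_mono power_mono) auto
  also have "\<dots> \<le> 3 ^ k * (2 * N * deriv_sup k)"
    using twisted_sum_decay[OF N, of 0 0 _ k] by simp
  finally have "norm ?S \<le> 3 ^ k * (2 * N * deriv_sup k) / \<rho> ^ k"
    using \<rho>(1) by (simp add: pos_le_divide_eq)
  then show ?thesis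
    unfolding fourier_term_def norm_mult of_int_of_nat_eq
    using norm_expsum_floor_le[OF N \<alpha>] N by (intro mult_mono) auto
qed

lemma norm_nonzero_frequencies_le:
  fixes c :: int
  assumes N: "1 \<le> N" and \<alpha>: "\<And>m. norm (\<alpha> m) \<le> 1" and q: "0 < q"
    and \<rho>: "0 < \<rho>" "\<rho> \<le> 4 * N * (real K + 1) / real q"
  defines "T \<equiv> nat \<lfloor>N\<rfloor>" and "\<theta> \<equiv> of_int c / real q"
  shows "norm (\<Sum>h\<in>{1..<q}. fourier_term \<alpha> N q c (int h))
    \<le> 2 * N * deriv_sup 0 * (expsum_multiples \<alpha> T K \<theta> + expsum_multiples (cnj \<circ> \<alpha>) T K \<theta>)
      + real q * (N * (3 ^ k * (2 * N * deriv_sup k) / \<rho> ^ k))"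
proof -
  define f where "f h = norm (fourier_term \<alpha> N q c h)" for h
  define E where "E = N * (3 ^ k * (2 * N * deriv_sup k) / \<rho> ^ k)"
  have f_le: "f h \<le> 2 * N * deriv_sup 0 * norm (expsum \<alpha> T (of_int h * \<theta>))" for h
    unfolding f_def T_def \<theta>_def by (rule norm_fourier_term_le[OF N])
  have "norm (\<Sum>h\<in>{1..<q}. fourier_term \<alpha> N q c (int h)) \<le> (\<Sum>h\<in>{1..<q}. f (int h))"
    unfolding f_def by (rule norm_sum)
  also have "\<dots> \<le> (\<Sum>h\<in>{1..K}. f (int h)) + (\<Sum>h\<in>{1..K}. f (- int h)) + real q * E"
  proof (rule sum_low_high_frequencies_le)
    show "f (h - int q) = f h" for h
      by (simp add: f_def fourier_term_diff_modulus[OF q])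
    show "f (int h) \<le> E" if "K < h" "h + K < q" for h
      unfolding f_def E_def by (rule norm_fourier_term_middle_le[OF N \<alpha> that \<rho>])
  qed (use N \<rho> deriv_sup_nonneg in \<open>simp_all add: f_def E_def\<close>)
  also have "\<dots> \<le> (\<Sum>h\<in>{1..K}. 2 * N * deriv_sup 0 * norm (expsum \<alpha> T (of_int (int h) * \<theta>)))
      + (\<Sum>h\<in>{1..K}. 2 * N * deriv_sup 0 * norm (expsum \<alpha> T (of_int (- int h) * \<theta>)))
      + real q * E"
    by (intro add_mono sum_mono f_le order_refl)
  finally show ?thesis
    by (simp add: expsum_multiples_def norm_expsum_uminus E_def distrib_left flip: sum_distrib_left)
qed

lemma psi_error_residue_lattice_eq:
  assumes N: "0 < N" and q: "0 < q"
  shows "psi_error W N \<alpha> (residue_lattice (int q) c) = norm (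
      (\<Sum>m\<in>{1..nat \<lfloor>N\<rfloor>}. \<alpha> m) * (twisted_sum 0 N 0 0 - of_real (N * integral UNIV W))
      + (\<Sum>h\<in>{1..<q}. fourier_term \<alpha> N q c (int h))) / real q"
proof -
  define A where "A = (\<Sum>m\<in>{1..nat \<lfloor>N\<rfloor>}. \<alpha> m)"
  define S where "S = twisted_sum 0 N 0 0"
  define F where "F = (\<Sum>h\<in>{1..<q}. fourier_term \<alpha> N q c (int h))"
  have "{..<q} = insert 0 {1..<q}" using q by auto
  then have psi: "psi W (residue_lattice (int q) c) N \<alpha> = (A * S + F) / of_nat q"
    using psi_residue_lattice_eq[OF q N, where c = c and \<alpha> = \<alpha>]
    by (simp add: A_def S_def F_def fourier_term_0)
  have "{m::nat. 1 \<le> m \<and> real m \<le> N} = {1..nat \<lfloor>N\<rfloor>}"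
    using N by (auto simp: le_nat_iff le_floor_iff)
  then have "(\<Sum>m\<in>{m::nat. 1 \<le> m \<and> real m \<le> N}. \<alpha> m) = A"
    by (simp add: A_def)
  moreover have "(A * S + F) / of_nat q - of_real (N * integral UNIV W / real q) * A
      = (A * (S - of_real (N * integral UNIV W)) + F) / of_nat q"
    using q by (simp add: field_simps)
  ultimately show ?thesis
    using q unfolding psi_error_def psi A_def[symmetric] S_def[symmetric] F_def[symmetric]
    by (simp add: lattice_det_residue_lattice norm_divide)
qed

lemma psi_error_residue_lattice_le:
  fixes c :: int
  assumes N: "1 \<le> N" and q: "0 < q" and \<alpha>: "\<And>m. norm (\<alpha> m) \<le> 1" and "0 < k"
    and \<rho>: "0 < \<rho>" "\<rho> \<le> 4 * N * (real K + 1) / real q"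
  defines "T \<equiv> nat \<lfloor>N\<rfloor>" and "\<theta> \<equiv> of_int c / real q"
  shows "psi_error W N \<alpha> (residue_lattice (int q) c)
    \<le> 2 * N * deriv_sup 0 / real q
        * (expsum_multiples \<alpha> T K \<theta> + expsum_multiples (cnj \<circ> \<alpha>) T K \<theta>)
      + 2 * 3 ^ k * deriv_sup k * N\<^sup>2 * (1 / N ^ k + 1 / \<rho> ^ k)"
    (is "_ \<le> _ * ?low + ?tail")
proof -
  define E where "E r = N * (3 ^ k * (2 * N * deriv_sup k) / r ^ k)" for r
  let ?zero = "(\<Sum>m\<in>{1..T}. \<alpha> m) * (twisted_sum 0 N 0 0 - of_real (N * integral UNIV W))"
    and ?nonzero = "\<Sum>h\<in>{1..<q}. fourier_term \<alpha> N q c (int h)"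
  have "norm ?zero \<le> real q * E N"
  proof -
    have "norm (twisted_sum 0 N 0 0 - of_real (N * integral UNIV W))
        \<le> 1 * (2 * N * deriv_sup k) / N ^ k"
      using twisted_sum_0_approx[OF N, of 0 "k - 1"] \<open>0 < k\<close> by simp
    also have "\<dots> \<le> 3 ^ k * (2 * N * deriv_sup k) / N ^ k"
      using N deriv_sup_nonneg by (intro divide_right_mono mult_right_mono) auto
    finally have "norm ?zero \<le> E N"
      unfolding E_def norm_mult using norm_expsum_floor_le[OF N \<alpha>, where \<theta> = 0] N
      by (intro mult_mono) (auto simp: T_def expsum_def)
    moreover have "1 * E N \<le> real q * E N"
      using N q deriv_sup_nonneg by (intro mult_right_mono) (auto simp: E_def)
    ultimately show ?thesis by simp
  qed
  moreover have "norm ?nonzero \<le> 2 * N * deriv_sup 0 * ?low + real q * E \<rho>"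
    unfolding T_def \<theta>_def E_def by (rule norm_nonzero_frequencies_le[OF N \<alpha> q \<rho>])
  ultimately have "norm (?zero + ?nonzero) \<le> 2 * N * deriv_sup 0 * ?low + real q * (E N + E \<rho>)"
    using norm_triangle_ineq[of ?zero ?nonzero] by (simp only: distrib_left)
  then have "psi_error W N \<alpha> (residue_lattice (int q) c)
      \<le> (2 * N * deriv_sup 0 * ?low + real q * (E N + E \<rho>)) / real q"
    using psi_error_residue_lattice_eq[of N q \<alpha> c] N q by (simp add: T_def divide_right_mono)
  also have "\<dots> = 2 * N * deriv_sup 0 / real q * ?low + ?tail"
    using q by (simp add: E_def add_divide_distrib distrib_left power2_eq_square mult_ac)
  finally show ?thesis .
qed

end

section \<open>Admissible families\<close>

locale reduced_lattice_family =
  fixes D M1 :: real and \<Lambda> :: "(int \<times> int) set set"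
    and B1 B2 :: "(int \<times> int) set \<Rightarrow> int \<times> int"
  assumes admissible: "admissible_family D M1 \<Lambda> B1 B2" and D_ge_1: "1 \<le> D" and M1_ge_1: "1 \<le> M1"
begin

lemma finite_family: "finite \<Lambda>"
  by (rule admissible_family_finite[OF admissible])

lemma inj_on_fst_B1: "inj_on (\<lambda>L. fst (B1 L)) \<Lambda>"
  using admissible unfolding admissible_family_def inj_on_def by metis

lemma card_family_le: "real (card \<Lambda>) \<le> 2 * M1"
proof -
  have "card \<Lambda> = card ((\<lambda>L. fst (B1 L)) ` \<Lambda>)"
    using inj_on_fst_B1 by (simp add: card_image)
  also have "\<dots> \<le> card {\<lceil>M1\<rceil>..<\<lceil>2 * M1\<rceil>}"
    using admissible
    by (intro card_mono) (auto simp: admissible_family_def ceiling_le_iff less_ceiling_iff)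
  finally show ?thesis using M1_ge_1 by (simp; linarith)
qed

lemma full_rank: "L \<in> \<Lambda> \<Longrightarrow> full_rank_lattice L"
  and det_ge: "L \<in> \<Lambda> \<Longrightarrow> D \<le> of_int (lattice_det L)"
  and det_less: "L \<in> \<Lambda> \<Longrightarrow> of_int (lattice_det L) < 2 * D"
  and fst_B1_ge: "L \<in> \<Lambda> \<Longrightarrow> M1 \<le> of_int (fst (B1 L))"
  and fst_B1_less: "L \<in> \<Lambda> \<Longrightarrow> of_int (fst (B1 L)) < 2 * M1"
  and reduced: "L \<in> \<Lambda> \<Longrightarrow> reduced_basis L (fst (B1 L), snd (B1 L)) (B2 L)"
  using admissible by (auto simp: admissible_family_def)

definition slope :: "(int \<times> int) set \<Rightarrow> int" where
  "slope L = (SOME c. L = residue_lattice (lattice_det L) c)"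

lemma residue_lattice_slope:
  assumes "L \<in> \<Lambda>"
  shows "residue_lattice (lattice_det L) (slope L) = L"
proof -
  have "\<exists>c. L = residue_lattice (lattice_det L) c"
    using assms admissible
    by (intro full_rank_lattice_eq_residue_lattice) (auto simp: admissible_family_def)
  then show ?thesis unfolding slope_def by (metis (mono_tags, lifting) someI_ex)
qed

definition freq :: "(int \<times> int) set \<Rightarrow> real" where
  "freq L = of_int (slope L) / of_int (lattice_det L)"

lemma B1_norm_sq_le:
  assumes "L \<in> \<Lambda>"
  shows "(of_int (fst (B1 L)))\<^sup>2 + (of_int (snd (B1 L)))\<^sup>2 \<le> 2 * real_of_int (lattice_det L)"
proof -
  have "(fst (B1 L))\<^sup>2 + (snd (B1 L))\<^sup>2 \<le> 2 * lattice_det L"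
    using assms full_rank reduced by (intro reduced_basis_norm_sq_le)
  then have "real_of_int ((fst (B1 L))\<^sup>2 + (snd (B1 L))\<^sup>2) \<le> real_of_int (2 * lattice_det L)"
    by (simp only: of_int_le_iff)
  then show ?thesis by simp
qed

lemma M1_sq_le:
  assumes "\<Lambda> \<noteq> {}"
  shows "M1\<^sup>2 \<le> 4 * D"
proof -
  obtain L where L: "L \<in> \<Lambda>" using assms by blast
  have "M1\<^sup>2 \<le> (of_int (fst (B1 L)))\<^sup>2"
    using M1_ge_1 fst_B1_ge[OF L] by (intro power_mono) auto
  then show ?thesis
    using B1_norm_sq_le[OF L] det_less[OF L] zero_le_power2[of "real_of_int (snd (B1 L))"]
    by linarith
qed

lemma M1_le_sqrt:
  assumes "\<Lambda> \<noteq> {}"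
  shows "M1 \<le> 2 * sqrt D"
  using real_sqrt_le_mono[OF M1_sq_le[OF assms]] M1_ge_1 by (simp add: real_sqrt_mult)

lemma abs_snd_B1_le:
  assumes "L \<in> \<Lambda>"
  shows "\<bar>of_int (snd (B1 L))\<bar> \<le> 2 * sqrt (of_int (lattice_det L))"
proof -
  have "(of_int (snd (B1 L)))\<^sup>2 \<le> 4 * real_of_int (lattice_det L)"
    using B1_norm_sq_le[OF assms] det_ge[OF assms] D_ge_1
      zero_le_power2[of "real_of_int (fst (B1 L))"]
    by linarith
  from real_sqrt_le_mono[OF this] show ?thesis by (simp add: real_sqrt_mult)
qed

lemma M1_le_of_D_le:
  assumes "\<Lambda> \<noteq> {}" "D \<le> M1 * X"
  shows "M1 \<le> 4 * X"
proof -
  have "M1 * M1 \<le> M1 * (4 * X)"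
    using M1_sq_le[OF assms(1)] assms(2) by (simp add: power2_eq_square)
  then show ?thesis using M1_ge_1 by simp
qed

lemma freq_near_reduced_fraction:
  assumes L: "L \<in> \<Lambda>"
  shows "\<exists>y. coprime y (fst (B1 L)) \<and>
    \<bar>freq L - of_int y / of_int (fst (B1 L))\<bar> \<le> 2 / (sqrt D * M1)"
proof -
  define q m n where "q = real_of_int (lattice_det L)" and "m = fst (B1 L)" and "n = snd (B1 L)"
  have m: "m > 0" "M1 \<le> of_int m" using fst_B1_ge[OF L] M1_ge_1 by (auto simp: m_def)
  have q: "D \<le> q" "q > 0" using det_ge[OF L] D_ge_1 by (auto simp: q_def)
  obtain y where y: "coprime y m" "slope L * m = y * lattice_det L + n"
    using reduced_basis_residue_lattice_coprime[of "lattice_det L" "slope L" m n "B2 L"]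
      reduced[OF L] m
    by (auto simp: residue_lattice_slope[OF L] m_def n_def)
  have "of_int (slope L) * of_int m = of_int y * q + real_of_int n"
    using y(2) unfolding q_def by (metis of_int_add of_int_mult)
  then have "freq L - of_int y / of_int m = of_int n / (q * of_int m)"
    using m q unfolding freq_def q_def[symmetric] by (simp add: field_simps)
  also have "\<bar>\<dots>\<bar> = \<bar>of_int n\<bar> / (q * of_int m)"
    using m q by (simp add: abs_mult)
  also have "\<dots> \<le> 2 * sqrt q / (q * M1)"
    using m q M1_ge_1 abs_snd_B1_le[OF L] by (intro frac_le mult_left_mono) (auto simp: q_def n_def)
  also have "\<dots> = 2 / (sqrt q * M1)"
    using q M1_ge_1 by (subst frac_eq_eq) (simp_all flip: mult.assoc)
  also have "\<dots> \<le> 2 / (sqrt D * M1)"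
    using q D_ge_1 M1_ge_1 by (intro divide_left_mono mult_right_mono mult_pos_pos) auto
  finally show ?thesis using y(1) unfolding m_def by blast
qed

lemma sieve_quantity_le:
  assumes "\<Lambda> \<noteq> {}" "D \<le> U" and u: "0 \<le> u" "u \<le> U" and \<eta>: "1 \<le> \<eta>"
  shows "u * (real (card \<Lambda>) * (2 * u + 8 * M1\<^sup>2 * \<eta>)) \<le> (9 * U * sqrt (M1 * \<eta>))\<^sup>2"
proof -
  have "u * 1 \<le> U * \<eta>" using u \<eta> by (intro mult_mono) auto
  moreover have "M1\<^sup>2 * \<eta> \<le> (4 * U) * \<eta>"
    using M1_sq_le[OF assms(1)] assms(2) \<eta> by (intro mult_right_mono) auto
  ultimately have "2 * u + 8 * M1\<^sup>2 * \<eta> \<le> 34 * U * \<eta>" by simp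
  then have "u * (real (card \<Lambda>) * (2 * u + 8 * M1\<^sup>2 * \<eta>)) \<le> U * (2 * M1 * (34 * U * \<eta>))"
    using u card_family_le \<eta> M1_ge_1 by (intro mult_mono) auto
  also have "\<dots> \<le> (9 * U)\<^sup>2 * (M1 * \<eta>)"
    using u \<eta> M1_ge_1 by (simp add: power2_eq_square)
  also have "\<dots> = (9 * U * sqrt (M1 * \<eta>))\<^sup>2"
    using \<eta> M1_ge_1 by (simp add: power_mult_distrib)
  finally show ?thesis .
qed

lemma sum_norm_expsum_fractions_le:
  assumes y: "\<And>L. L \<in> \<Lambda> \<Longrightarrow> coprime (y L) (fst (B1 L))" and ne: "\<Lambda> \<noteq> {}"
    and K: "real K < M1" and U: "real t * real K \<le> U" "D \<le> U" and n: "2 * M1\<^sup>2 \<le> real n"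
    and \<alpha>: "\<And>m. norm (\<alpha> m) \<le> 1"
  shows "(\<Sum>(L, h)\<in>\<Lambda> \<times> {1..K}. norm (expsum \<alpha> t (real h * of_int (y L) / of_int (fst (B1 L)))))
    \<le> 9 * U * sqrt (M1 * harm n)"
proof -
  have "1 \<le> M1\<^sup>2" using M1_ge_1 by simp
  then have "1 \<le> n" using n by linarith
  then have harm: "1 \<le> (harm n :: real)" using harm_mono[of 1 n] by (simp add: harm_def)
  have "(\<Sum>(L, h)\<in>\<Lambda> \<times> {1..K}. norm (expsum \<alpha> t (real h * of_int (y L) / of_int (fst (B1 L)))))
      \<le> sqrt (real t * (real (card \<Lambda>) * real K * (2 * real t * real K + 2 * (2 * M1)\<^sup>2 * harm n)))"
  proof (rule large_sieve_multiples_of_fractions[OF finite_family inj_on_fst_B1 y _ _ _ _ \<alpha>])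
    show "int K < fst (B1 L)" if "L \<in> \<Lambda>" for L
      using K fst_B1_ge[OF that] by linarith
  qed (use fst_B1_less M1_ge_1 n in \<open>auto simp: power_mult_distrib intro: less_imp_le\<close>)
  also have "\<dots> \<le> 9 * U * sqrt (M1 * harm n)"
    using sieve_quantity_le[OF ne U(2) _ U(1) harm] U D_ge_1 M1_ge_1 harm
    by (intro real_le_lsqrt) (simp_all add: power_mult_distrib mult_ac)
  finally show ?thesis .
qed

lemma perturbation_factor_le:
  assumes ne: "\<Lambda> \<noteq> {}" and U: "t * r \<le> U" "D \<le> U" and "0 \<le> t" "0 \<le> r"
  shows "1 + 2 * pi * \<bar>r * (2 / (sqrt D * M1))\<bar> * t \<le> 18 * (U / (sqrt D * M1))"
proof -
  define V where "V = U / (sqrt D * M1)"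
  define s where "s = \<bar>r * (2 / (sqrt D * M1))\<bar> * t"
  have pos: "0 < sqrt D * M1" using D_ge_1 M1_ge_1 by simp
  have "sqrt D * M1 \<le> sqrt D * (2 * sqrt D)"
    using M1_le_sqrt[OF ne] D_ge_1 by (intro mult_left_mono) auto
  also have "\<dots> \<le> 2 * U" using D_ge_1 U(2) by simp
  finally have V: "1 \<le> 2 * V"
    using pos unfolding V_def times_divide_eq_right by (subst pos_le_divide_eq) auto
  have "s = 2 * (t * r / (sqrt D * M1))"
    using D_ge_1 M1_ge_1 assms(4,5) by (simp add: s_def abs_mult)
  also have "\<dots> \<le> 2 * V"
    unfolding V_def using U(1) pos by (intro mult_left_mono divide_right_mono) auto
  finally have "(2 * pi) * s \<le> (2 * 4) * (2 * V)"
    by (rule mult_mono[rotated]) (use pi_less_4 assms(4) in \<open>auto simp: s_def\<close>)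
  with V have "1 + 2 * pi * s \<le> 18 * V" by linarith
  then show ?thesis by (simp only: V_def s_def mult.assoc)
qed

lemma sum_expsum_multiples_freq_le:
  assumes ne: "\<Lambda> \<noteq> {}" and K: "real K < M1" and U: "real T * real K \<le> U" "D \<le> U"
    and n: "2 * M1\<^sup>2 \<le> real n" and \<alpha>: "\<And>m. norm (\<alpha> m) \<le> 1"
  shows "(\<Sum>L\<in>\<Lambda>. expsum_multiples \<alpha> T K (freq L))
    \<le> 162 * U\<^sup>2 * sqrt (harm n) / (sqrt D * sqrt M1)"
proof -
  obtain y where y: "\<And>L. L \<in> \<Lambda> \<Longrightarrow> coprime (y L) (fst (B1 L))"
    "\<And>L. L \<in> \<Lambda> \<Longrightarrow> \<bar>freq L - of_int (y L) / of_int (fst (B1 L))\<bar> \<le> 2 / (sqrt D * M1)"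
    using freq_near_reduced_fraction by metis
  define x where "x = (\<lambda>(L, h). real h * of_int (y L) / of_int (fst (B1 L)))"
  define \<beta> where "\<beta> = (\<lambda>(L, h). real h * (freq L - of_int (y L) / of_int (fst (B1 L))))"
  define B where "B = real K * (2 / (sqrt D * M1))"
  have "(\<Sum>L\<in>\<Lambda>. expsum_multiples \<alpha> T K (freq L))
      = (\<Sum>p\<in>\<Lambda> \<times> {1..K}. norm (expsum \<alpha> T (x p + \<beta> p)))"
    by (simp add: expsum_multiples_def sum.cartesian_product x_def \<beta>_def case_prod_unfold
        right_diff_distrib)
  also have "\<dots> \<le> (1 + 2 * pi * \<bar>B\<bar> * real T) * (9 * U * sqrt (M1 * harm n))"
  proof (rule sum_norm_expsum_add_le)
    show "\<bar>\<beta> p\<bar> \<le> B" if "p \<in> \<Lambda> \<times> {1..K}" for p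
      using that y(2)[of "fst p"] unfolding \<beta>_def B_def case_prod_unfold abs_mult
      by (intro mult_mono) auto
    show "(\<Sum>p\<in>\<Lambda> \<times> {1..K}. norm (expsum \<alpha> t (x p))) \<le> 9 * U * sqrt (M1 * harm n)" if "t \<le> T" for t
    proof -
      have "real t * real K \<le> real T * real K" using that by (intro mult_right_mono) auto
      then show ?thesis
        using sum_norm_expsum_fractions_le[OF y(1) ne K _ U(2) n \<alpha>, of t] U(1)
        by (simp add: x_def case_prod_unfold)
    qed
  qed
  also have "\<dots> \<le> 18 * (U / (sqrt D * M1)) * (9 * U * sqrt (M1 * harm n))"
    using perturbation_factor_le[OF ne U] U(2) D_ge_1 M1_ge_1 harm_nonneg[where 'a = real, of n]
    by (intro mult_right_mono) (simp_all add: B_def)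
  also have "\<dots> = 162 * U\<^sup>2 * sqrt (harm n) * (sqrt M1 / M1) / sqrt D"
    by (simp add: real_sqrt_mult power2_eq_square mult_ac)
  also have "sqrt M1 / M1 = 1 / sqrt M1"
    using M1_ge_1 by (simp add: frac_eq_eq)
  finally show ?thesis by (simp add: mult.commute)
qed

end

lemma harm_le_powr:
  assumes "0 < \<epsilon>" "1 \<le> n"
  shows "harm n \<le> (1 + 1 / \<epsilon>) * real n powr \<epsilon>"
proof -
  have "harm n - ln (real n) \<le> harm 1 - ln (real 1)"
    using assms(2) euler_mascheroni_sequence_decreasing[of 1 n] by simp
  then have "harm n \<le> 1 + ln (real n)" by (simp add: harm_def)
  also have "\<dots> \<le> real n powr \<epsilon> + real n powr \<epsilon> / \<epsilon>"
    using assms by (intro add_mono ge_one_powr_ge_zero ln_powr_bound) auto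
  finally show ?thesis by (simp add: algebra_simps)
qed

lemma sqrt_harm_le_powr:
  fixes M N :: real
  assumes \<epsilon>: "0 < \<epsilon>" and M: "1 \<le> M" "M \<le> 4 * N" and N: "1 \<le> N"
  shows "sqrt (harm (nat \<lceil>2 * M\<^sup>2\<rceil>)) \<le> sqrt ((1 + 1 / \<epsilon>) * 33 powr \<epsilon>) * N powr \<epsilon>"
proof -
  define n where "n = nat \<lceil>2 * M\<^sup>2\<rceil>"
  have "1 \<le> M\<^sup>2" using M(1) by simp
  moreover have "2 * M\<^sup>2 \<le> real n" unfolding n_def by (rule real_nat_ceiling_ge)
  ultimately have n: "1 \<le> n" by linarith
  have "M\<^sup>2 \<le> (4 * N)\<^sup>2" using M by (intro power_mono) auto
  moreover have "1 \<le> N\<^sup>2" using N by simp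
  ultimately have "real n \<le> 33 * N\<^sup>2" unfolding n_def by (simp add: power_mult_distrib; linarith)
  then have "real n powr \<epsilon> \<le> (33 * N\<^sup>2) powr \<epsilon>" using \<epsilon> by (intro powr_mono2) auto
  also have "\<dots> = 33 powr \<epsilon> * (N powr \<epsilon>)\<^sup>2"
    using N by (simp add: powr_mult power2_eq_square)
  finally have "(1 + 1 / \<epsilon>) * real n powr \<epsilon> \<le> (1 + 1 / \<epsilon>) * (33 powr \<epsilon> * (N powr \<epsilon>)\<^sup>2)"
    using \<epsilon> by (intro mult_left_mono) auto
  then have "harm n \<le> (1 + 1 / \<epsilon>) * 33 powr \<epsilon> * (N powr \<epsilon>)\<^sup>2"
    using harm_le_powr[OF \<epsilon> n] by simp
  then have "sqrt (harm n) \<le> sqrt ((1 + 1 / \<epsilon>) * 33 powr \<epsilon> * (N powr \<epsilon>)\<^sup>2)"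
    by (rule real_sqrt_le_mono)
  then show ?thesis by (simp add: real_sqrt_mult n_def)
qed

lemma powr_le_power_of_powr:
  fixes N :: real
  assumes "1 \<le> N" "a \<le> \<delta> * real k"
  shows "N powr a \<le> (N powr \<delta>) ^ k"
proof -
  have "N powr a \<le> N powr (\<delta> * real k)" using assms by (intro powr_mono) auto
  then show ?thesis using assms(1) by (simp add: powr_powr[symmetric] powr_realpow)
qed

lemma power2_mult_inverse_powers_le:
  fixes N d :: real
  assumes "1 \<le> N" "2 \<le> k" "N\<^sup>2 \<le> d ^ k"
  shows "N\<^sup>2 * (1 / N ^ k + 1 / d ^ k) \<le> 2"
proof -
  have "0 < N\<^sup>2" using assms(1) by simp
  moreover have Nk: "N\<^sup>2 \<le> N ^ k" using assms by (intro power_increasing)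
  ultimately have "0 < N ^ k" "0 < d ^ k" using assms(3) by linarith+
  then have "N\<^sup>2 / N ^ k \<le> 1" "N\<^sup>2 / d ^ k \<le> 1"
    using Nk assms(3) by simp_all
  then show ?thesis by (simp add: distrib_left)
qed

locale weighted_lattice_family = smooth_weight W + reduced_lattice_family D M1 \<Lambda> B1 B2
  for W D M1 \<Lambda> B1 B2 +
  fixes N :: real and \<alpha> :: "nat \<Rightarrow> complex"
  assumes N_ge_1: "1 \<le> N" and norm_\<alpha>_le: "\<And>m. norm (\<alpha> m) \<le> 1"
begin

definition low_frequency_sum :: "nat \<Rightarrow> (nat \<Rightarrow> complex) \<Rightarrow> real" where
  "low_frequency_sum K \<gamma> = (\<Sum>L\<in>\<Lambda>. expsum_multiples \<gamma> (nat \<lfloor>N\<rfloor>) K (freq L))"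

lemma sum_psi_error_le:
  assumes "0 < k" "0 < \<rho>" "\<rho> * D \<le> N * (real K + 1)"
  shows "(\<Sum>L\<in>\<Lambda>. psi_error W N \<alpha> L)
    \<le> 2 * N * deriv_sup 0 / D * (low_frequency_sum K \<alpha> + low_frequency_sum K (cnj \<circ> \<alpha>))
      + 2 * M1 * (2 * 3 ^ k * deriv_sup k * N\<^sup>2 * (1 / N ^ k + 1 / \<rho> ^ k))"
proof -
  let ?low = "\<lambda>\<gamma> L. expsum_multiples \<gamma> (nat \<lfloor>N\<rfloor>) K (freq L)"
  define E where "E = 2 * 3 ^ k * deriv_sup k * N\<^sup>2 * (1 / N ^ k + 1 / \<rho> ^ k)"
  have E0: "0 \<le> E" using deriv_sup_nonneg N_ge_1 assms(2) by (simp add: E_def)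
  have "psi_error W N \<alpha> L \<le> 2 * N * deriv_sup 0 / D * (?low \<alpha> L + ?low (cnj \<circ> \<alpha>) L) + E"
    if L: "L \<in> \<Lambda>" for L
  proof -
    obtain q where q: "lattice_det L = int q" "0 < q"
      using full_rank_lattice_det_pos[OF full_rank[OF L]] zero_less_imp_eq_int by metis
    have "\<rho> * real q \<le> \<rho> * (4 * D)"
      using det_less[OF L] D_ge_1 assms(2) by (intro mult_left_mono) (auto simp: q)
    then have \<rho>: "\<rho> \<le> 4 * N * (real K + 1) / real q"
      using assms(3) q(2) by (simp add: pos_le_divide_eq)
    have "psi_error W N \<alpha> L \<le> 2 * N * deriv_sup 0 / real q * (?low \<alpha> L + ?low (cnj \<circ> \<alpha>) L) + E"
      using psi_error_residue_lattice_le[OF N_ge_1 q(2) norm_\<alpha>_le assms(1,2) \<rho>, where c = "slope L"]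
        residue_lattice_slope[OF L] by (simp add: q freq_def E_def)
    also have "\<dots> \<le> 2 * N * deriv_sup 0 / D * (?low \<alpha> L + ?low (cnj \<circ> \<alpha>) L) + E"
      using det_ge[OF L] D_ge_1 N_ge_1 deriv_sup_nonneg q
      by (intro add_right_mono mult_right_mono divide_left_mono)
        (auto intro: expsum_multiples_nonneg add_nonneg_nonneg)
    finally show ?thesis .
  qed
  then have "(\<Sum>L\<in>\<Lambda>. psi_error W N \<alpha> L)
      \<le> (\<Sum>L\<in>\<Lambda>. 2 * N * deriv_sup 0 / D * (?low \<alpha> L + ?low (cnj \<circ> \<alpha>) L) + E)"
    by (rule sum_mono)
  also have "\<dots> = 2 * N * deriv_sup 0 / D * (low_frequency_sum K \<alpha> + low_frequency_sum K (cnj \<circ> \<alpha>))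
      + real (card \<Lambda>) * E"
    by (simp only: sum.distrib low_frequency_sum_def flip: sum_distrib_left) simp
  also have "real (card \<Lambda>) * E \<le> 2 * M1 * E"
    by (rule mult_right_mono[OF card_family_le E0])
  finally show ?thesis by (simp only: E_def)
qed

lemma sum_psi_error_le_small_det:
  assumes \<delta>: "0 < \<delta>" and DN: "D \<le> N powr (1 - \<delta>)" and k: "0 < k" "A + 3 \<le> \<delta> * real k"
  shows "(\<Sum>L\<in>\<Lambda>. psi_error W N \<alpha> L) \<le> 32 * 3 ^ k * deriv_sup k * N powr (- A)"
proof (cases "\<Lambda> = {}")
  case True
  then show ?thesis using deriv_sup_nonneg by simp
next
  case False
  define d where "d = N powr \<delta>"
  have d: "1 \<le> d" unfolding d_def using N_ge_1 \<delta> by (intro ge_one_powr_ge_zero) auto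
  have dD: "d * D \<le> N" using DN N_ge_1 d by (simp add: d_def powr_diff field_simps)
  have "d * 1 \<le> d * D" "1 * D \<le> d * D" using d D_ge_1 by (intro mult_mono; simp)+
  then have dN: "d \<le> N" "D \<le> N" using dD by simp_all
  have "1 * N \<le> M1 * N" using M1_ge_1 N_ge_1 by (intro mult_right_mono) auto
  then have M1: "M1 \<le> 4 * N" using M1_le_of_D_le[OF False, of N] dN(2) by simp
  have dk: "N powr A * N ^ 3 \<le> d ^ k"
    using powr_le_power_of_powr[OF N_ge_1 k(2)] N_ge_1 by (simp add: d_def powr_add powr_numeral)
  have "(\<Sum>L\<in>\<Lambda>. psi_error W N \<alpha> L)
      \<le> 2 * M1 * (2 * 3 ^ k * deriv_sup k * N\<^sup>2 * (1 / N ^ k + 1 / d ^ k))"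
    using sum_psi_error_le[OF k(1), of d 0] d dD
    by (simp add: low_frequency_sum_def expsum_multiples_def)
  also have "\<dots> \<le> 2 * (4 * N) * (2 * 3 ^ k * deriv_sup k * N\<^sup>2 * (1 / d ^ k + 1 / d ^ k))"
    using M1 M1_ge_1 N_ge_1 d dN deriv_sup_nonneg
    by (intro mult_mono add_mono divide_left_mono power_mono) auto
  also have "\<dots> = 32 * 3 ^ k * deriv_sup k * (N ^ 3 / d ^ k)"
    by (simp add: power2_eq_square power3_eq_cube)
  also have "\<dots> \<le> 32 * 3 ^ k * deriv_sup k * (N ^ 3 / (N powr A * N ^ 3))"
    using dk d N_ge_1 deriv_sup_nonneg by (intro mult_left_mono divide_left_mono) auto
  also have "\<dots> = 32 * 3 ^ k * deriv_sup k * N powr (- A)"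
    using N_ge_1 by (simp add: powr_minus_divide)
  finally show ?thesis .
qed

definition large_det_bound :: "real \<Rightarrow> real \<Rightarrow> real" where
  "large_det_bound \<delta> \<epsilon> = N powr (1 + 2 * \<delta> + \<epsilon>) * M1 powr (- 1 / 2) * D powr (1 / 2)"

lemma large_det_bound_eq:
  "large_det_bound \<delta> \<epsilon> = N * (N powr \<delta>)\<^sup>2 * N powr \<epsilon> * sqrt D / sqrt M1"
proof -
  have "N powr (1 + 2 * \<delta> + \<epsilon>) = N * (N powr \<delta>)\<^sup>2 * N powr \<epsilon>"
    using N_ge_1 powr_add[of N \<delta> \<delta>] by (simp add: powr_add power2_eq_square)
  moreover have "M1 powr (- 1 / 2) = 1 / sqrt M1"
    using M1_ge_1 powr_minus_divide[of M1 "1/2"] by (simp add: powr_half_sqrt)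
  ultimately show ?thesis using D_ge_1 by (simp add: large_det_bound_def powr_half_sqrt)
qed

lemma low_frequency_sum_le:
  assumes ne: "\<Lambda> \<noteq> {}" and \<delta>: "0 < \<delta>" and DN: "D * N powr \<delta> < M1 * N" and \<epsilon>: "0 < \<epsilon>"
    and \<gamma>: "\<And>m. norm (\<gamma> m) \<le> 1" and M1: "M1 \<le> 4 * N"
  shows "low_frequency_sum (nat \<lfloor>D * N powr \<delta> / N\<rfloor>) \<gamma>
    \<le> 162 * sqrt ((1 + 1 / \<epsilon>) * 33 powr \<epsilon>) * (D * (large_det_bound \<delta> \<epsilon> / N))"
proof -
  define d where "d = N powr \<delta>"
  define K where "K = nat \<lfloor>D * d / N\<rfloor>"
  define n where "n = nat \<lceil>2 * M1\<^sup>2\<rceil>"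
  have N: "0 < N" using N_ge_1 by simp
  have d: "1 \<le> d" unfolding d_def using N_ge_1 \<delta> by (intro ge_one_powr_ge_zero) auto
  have K: "real K \<le> D * d / N" using D_ge_1 d N by (simp add: K_def)
  also have "\<dots> < M1" using DN N by (simp add: d_def pos_divide_less_eq)
  finally have KM: "real K < M1" .
  have "real (nat \<lfloor>N\<rfloor>) * real K \<le> N * (D * d / N)"
    using K N by (intro mult_mono) auto
  then have TK: "real (nat \<lfloor>N\<rfloor>) * real K \<le> D * d" using N by simp
  have "low_frequency_sum K \<gamma> \<le> 162 * (D * d)\<^sup>2 * sqrt (harm n) / (sqrt D * sqrt M1)"
    unfolding low_frequency_sum_def n_def
    using D_ge_1 d by (intro sum_expsum_multiples_freq_le[OF ne KM TK _ real_nat_ceiling_ge \<gamma>])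
      (auto simp: mult_le_cancel_left1)
  also have "\<dots> \<le> 162 * (D * d)\<^sup>2 * (sqrt ((1 + 1 / \<epsilon>) * 33 powr \<epsilon>) * N powr \<epsilon>) / (sqrt D * sqrt M1)"
    unfolding n_def using sqrt_harm_le_powr[OF \<epsilon> M1_ge_1 M1 N_ge_1] D_ge_1 M1_ge_1
    by (intro divide_right_mono mult_left_mono) auto
  also have "\<dots> = 162 * sqrt ((1 + 1 / \<epsilon>) * 33 powr \<epsilon>)
      * (D * (d\<^sup>2 * N powr \<epsilon> * (D / sqrt D) / sqrt M1))"
    by (simp add: power_mult_distrib power2_eq_square mult_ac)
  also have "d\<^sup>2 * N powr \<epsilon> * (D / sqrt D) / sqrt M1 = large_det_bound \<delta> \<epsilon> / N"
    using D_ge_1 N by (simp add: large_det_bound_eq d_def real_div_sqrt)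
  finally show ?thesis by (simp only: K_def d_def)
qed

lemma M1_le_large_det_bound:
  assumes ne: "\<Lambda> \<noteq> {}" and "0 < \<delta>" "0 < \<epsilon>" and M1: "M1 \<le> 4 * N"
  shows "M1 \<le> 8 * large_det_bound \<delta> \<epsilon>"
proof -
  have "M1 \<le> M1\<^sup>2" using M1_ge_1 by (simp add: power2_eq_square)
  then have "sqrt M1 \<le> sqrt (4 * D)" using M1_sq_le[OF ne] by simp
  then have "1 \<le> 2 * (sqrt D / sqrt M1)" using M1_ge_1 by (simp add: real_sqrt_mult field_simps)
  moreover have "1 \<le> (N powr \<delta>)\<^sup>2" "1 \<le> N powr \<epsilon>"
    using assms(2,3) N_ge_1 by (intro one_le_power ge_one_powr_ge_zero; simp)+
  ultimately have "1 \<le> (N powr \<delta>)\<^sup>2 * N powr \<epsilon> * (2 * (sqrt D / sqrt M1))"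
    by (metis mult_ge1_I)
  then have "N * 1 \<le> N * ((N powr \<delta>)\<^sup>2 * N powr \<epsilon> * (2 * (sqrt D / sqrt M1)))"
    using N_ge_1 by (intro mult_left_mono) auto
  then show ?thesis using M1 by (simp add: large_det_bound_eq mult.assoc)
qed

lemma tail_le_large_det_bound:
  assumes ne: "\<Lambda> \<noteq> {}" and "0 < \<delta>" "0 < \<epsilon>" and "M1 \<le> 4 * N"
    and k: "2 \<le> k" "2 \<le> \<delta> * real k"
  shows "2 * M1 * (2 * 3 ^ k * deriv_sup k * N\<^sup>2 * (1 / N ^ k + 1 / (N powr \<delta>) ^ k))
    \<le> 64 * 3 ^ k * deriv_sup k * large_det_bound \<delta> \<epsilon>"
proof -
  have "N\<^sup>2 \<le> (N powr \<delta>) ^ k"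
    using powr_le_power_of_powr[OF N_ge_1 k(2)] N_ge_1 by (simp add: powr_numeral)
  then have "M1 * (N\<^sup>2 * (1 / N ^ k + 1 / (N powr \<delta>) ^ k)) \<le> (8 * large_det_bound \<delta> \<epsilon>) * 2"
    using M1_le_large_det_bound[OF assms(1-4)] power2_mult_inverse_powers_le[OF N_ge_1 k(1)]
      M1_ge_1 N_ge_1
    by (intro mult_mono) auto
  then have "4 * 3 ^ k * deriv_sup k * (M1 * (N\<^sup>2 * (1 / N ^ k + 1 / (N powr \<delta>) ^ k)))
      \<le> 4 * 3 ^ k * deriv_sup k * ((8 * large_det_bound \<delta> \<epsilon>) * 2)"
    using deriv_sup_nonneg by (intro mult_left_mono) auto
  then show ?thesis by (simp add: mult_ac)
qed

lemma sum_psi_error_le_large_det: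
  assumes \<delta>: "0 < \<delta>" and \<epsilon>: "0 < \<epsilon>" and DN: "D < M1 * N powr (1 - \<delta>)"
    and k: "2 \<le> k" "2 \<le> \<delta> * real k"
  shows "(\<Sum>L\<in>\<Lambda>. psi_error W N \<alpha> L)
    \<le> (648 * deriv_sup 0 * sqrt ((1 + 1 / \<epsilon>) * 33 powr \<epsilon>) + 64 * 3 ^ k * deriv_sup k)
      * large_det_bound \<delta> \<epsilon>"
proof (cases "\<Lambda> = {}")
  case True
  then show ?thesis using deriv_sup_nonneg \<epsilon> by (simp add: large_det_bound_def)
next
  case False
  define d where "d = N powr \<delta>"
  define K where "K = nat \<lfloor>D * d / N\<rfloor>"
  define c where "c = sqrt ((1 + 1 / \<epsilon>) * 33 powr \<epsilon>)"
  define P where "P = large_det_bound \<delta> \<epsilon>"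
  have N: "0 < N" using N_ge_1 by simp
  have d: "1 \<le> d" unfolding d_def using N_ge_1 \<delta> by (intro ge_one_powr_ge_zero) auto
  have Dd: "D * d < M1 * N" using DN N d by (simp add: d_def powr_diff pos_less_divide_eq)
  have "D * 1 \<le> D * d" using d D_ge_1 by (intro mult_left_mono) auto
  then have M1: "M1 \<le> 4 * N" using M1_le_of_D_le[OF False, of N] Dd by simp
  have low: "low_frequency_sum K \<gamma> \<le> 162 * c * (D * (P / N))" if "\<And>m. norm (\<gamma> m) \<le> 1" for \<gamma>
    unfolding K_def P_def c_def d_def
    by (rule low_frequency_sum_le[OF False \<delta> Dd[unfolded d_def] \<epsilon> that M1])
  have "D * d / N \<le> real K + 1" unfolding K_def by linarith
  then have "d * D \<le> N * (real K + 1)" using N by (simp add: field_simps)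
  then have "(\<Sum>L\<in>\<Lambda>. psi_error W N \<alpha> L)
      \<le> 2 * N * deriv_sup 0 / D * (low_frequency_sum K \<alpha> + low_frequency_sum K (cnj \<circ> \<alpha>))
        + 2 * M1 * (2 * 3 ^ k * deriv_sup k * N\<^sup>2 * (1 / N ^ k + 1 / d ^ k))"
    using k d by (intro sum_psi_error_le) auto
  also have "\<dots> \<le> 2 * N * deriv_sup 0 / D * (162 * c * (D * (P / N)) + 162 * c * (D * (P / N)))
        + 64 * 3 ^ k * deriv_sup k * P"
    using tail_le_large_det_bound[OF False \<delta> \<epsilon> M1 k] norm_\<alpha>_le N D_ge_1 deriv_sup_nonneg
    by (intro add_mono mult_left_mono low) (auto simp: d_def P_def)
  also have "\<dots> = (648 * deriv_sup 0 * c + 64 * 3 ^ k * deriv_sup k) * P"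
    using N D_ge_1 by (simp add: algebra_simps)
  finally show ?thesis by (simp only: c_def P_def)
qed

end

context smooth_weight
begin

lemma ex_sum_psi_error_bound_small_det:
  assumes \<delta>: "0 < \<delta>"
  shows "\<exists>C::real. \<forall>(N::real) D M1 (\<alpha>::nat \<Rightarrow> complex) \<Lambda> B1 B2.
      1 \<le> N \<and> 1 \<le> D \<and> 1 \<le> M1 \<and> (\<forall>m. norm (\<alpha> m) \<le> 1) \<and>
      admissible_family D M1 \<Lambda> B1 B2 \<and> D \<le> N powr (1 - \<delta>) \<longrightarrow>
      (\<Sum>L\<in>\<Lambda>. psi_error W N \<alpha> L) \<le> C * N powr (- A)"
proof -
  obtain k where "max 1 ((A + 3) / \<delta>) \<le> real k" using real_arch_simple by blast
  then have k: "0 < k" "A + 3 \<le> \<delta> * real k" using \<delta> by (auto simp: field_simps)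
  show ?thesis
  proof (intro exI allI impI, elim conjE)
    fix N D M1 :: real and \<alpha> :: "nat \<Rightarrow> complex" and \<Lambda> B1 B2
    assume "1 \<le> N" "1 \<le> D" "1 \<le> M1" "\<forall>m. norm (\<alpha> m) \<le> 1" "admissible_family D M1 \<Lambda> B1 B2"
      and DN: "D \<le> N powr (1 - \<delta>)"
    then interpret weighted_lattice_family W D M1 \<Lambda> B1 B2 N \<alpha> by unfold_locales auto
    show "(\<Sum>L\<in>\<Lambda>. psi_error W N \<alpha> L) \<le> 32 * 3 ^ k * deriv_sup k * N powr (- A)"
      by (rule sum_psi_error_le_small_det[OF \<delta> DN k])
  qed
qed

lemma ex_sum_psi_error_bound_large_det:
  assumes \<delta>: "0 < \<delta>" and \<epsilon>: "0 < \<epsilon>"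
  shows "\<exists>C::real. \<forall>(N::real) D M1 (\<alpha>::nat \<Rightarrow> complex) \<Lambda> B1 B2.
      1 \<le> N \<and> 1 \<le> D \<and> 1 \<le> M1 \<and> (\<forall>m. norm (\<alpha> m) \<le> 1) \<and>
      admissible_family D M1 \<Lambda> B1 B2 \<and>
      N powr (1 - \<delta>) \<le> D \<and> D < M1 * N powr (1 - \<delta>) \<longrightarrow>
      (\<Sum>L\<in>\<Lambda>. psi_error W N \<alpha> L)
        \<le> C * N powr (1 + 2 * \<delta> + \<epsilon>) * M1 powr (- 1 / 2) * D powr (1 / 2)"
proof -
  obtain k where "max 2 (2 / \<delta>) \<le> real k" using real_arch_simple by blast
  then have k: "2 \<le> k" "2 \<le> \<delta> * real k" using \<delta> by (auto simp: field_simps)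
  show ?thesis
  proof (intro exI allI impI, elim conjE)
    fix N D M1 :: real and \<alpha> :: "nat \<Rightarrow> complex" and \<Lambda> B1 B2
    assume "1 \<le> N" "1 \<le> D" "1 \<le> M1" "\<forall>m. norm (\<alpha> m) \<le> 1" "admissible_family D M1 \<Lambda> B1 B2"
      and DN: "D < M1 * N powr (1 - \<delta>)"
    then interpret weighted_lattice_family W D M1 \<Lambda> B1 B2 N \<alpha> by unfold_locales auto
    show "(\<Sum>L\<in>\<Lambda>. psi_error W N \<alpha> L)
        \<le> (648 * deriv_sup 0 * sqrt ((1 + 1 / \<epsilon>) * 33 powr \<epsilon>) + 64 * 3 ^ k * deriv_sup k)
          * N powr (1 + 2 * \<delta> + \<epsilon>) * M1 powr (- 1 / 2) * D powr (1 / 2)"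
      using sum_psi_error_le_large_det[OF \<delta> \<epsilon> DN k]
      by (simp only: large_det_bound_def mult.assoc)
  qed
qed

end

theorem theorem2:
  fixes W :: "real \<Rightarrow> real" and \<delta> :: real
  assumes "smooth W"
    and "\<And>t. 0 \<le> W t"
    and "closure {t. W t \<noteq> 0} \<subseteq> {0..1}"
    and "0 < \<delta>"
  shows "(\<forall>A>0. \<exists>C::real. \<forall>(N::real) D M1 (\<alpha>::nat \<Rightarrow> complex) \<Lambda> B1 B2.
      1 \<le> N \<and> 1 \<le> D \<and> 1 \<le> M1 \<and> (\<forall>m. norm (\<alpha> m) \<le> 1) \<and>
      admissible_family D M1 \<Lambda> B1 B2 \<and> D \<le> N powr (1 - \<delta>) \<longrightarrow>
      (\<Sum>L\<in>\<Lambda>. norm (psi W L N \<alpha> -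
          complex_of_real (N * integral UNIV W / real_of_int (lattice_det L)) *
          (\<Sum>m\<in>{m::nat. 1 \<le> m \<and> real m \<le> N}. \<alpha> m)))
        \<le> C * N powr (- A))
    \<and> (\<forall>\<epsilon>>0. \<exists>C::real. \<forall>(N::real) D M1 (\<alpha>::nat \<Rightarrow> complex) \<Lambda> B1 B2.
      1 \<le> N \<and> 1 \<le> D \<and> 1 \<le> M1 \<and> (\<forall>m. norm (\<alpha> m) \<le> 1) \<and>
      admissible_family D M1 \<Lambda> B1 B2 \<and>
      N powr (1 - \<delta>) \<le> D \<and> D < M1 * N powr (1 - \<delta>) \<longrightarrow>
      (\<Sum>L\<in>\<Lambda>. norm (psi W L N \<alpha> -
          complex_of_real (N * integral UNIV W / real_of_int (lattice_det L)) *
          (\<Sum>m\<in>{m::nat. 1 \<le> m \<and> real m \<le> N}. \<alpha> m)))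
        \<le> C * N powr (1 + 2 * \<delta> + \<epsilon>) * M1 powr (- 1 / 2) * D powr (1 / 2))"
proof -
  interpret smooth_weight W
    using assms by unfold_locales
  show ?thesis
    unfolding psi_error_def[symmetric]
    using ex_sum_psi_error_bound_small_det[OF assms(4)]
      ex_sum_psi_error_bound_large_det[OF assms(4)]
    by simp
qed

end
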